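(* If a covering $\mathcal{C}$ of $\mathbb{R}^2$ by complete folding curves satisfies the local isomorphism property, then $\mathcal{C}$ consists of at most $6$ curves.
   Context: All sequences take values in $\{+1,-1\}$. For a finite sequence $S=(a_1,\dots,a_n)$ write $\overline{S}=(-a_n,\dots,-a_1)$. The $n$-folding sequences are defined recursively: the only $0$-folding sequence is the empty sequence, and the $(n+1)$-folding sequences are exactly $(\overline{S},+1,S)$ and $(\overline{S},-1,S)$ with $S$ an $n$-folding sequence. A subword of a sequence $(b_k)$ is a block $(b_{h+1},\dots,b_{h+m})$. A complete folding sequence is a sequence $(a_k)_{k\in\mathbb{Z}}$ each finite subword of which is a subword of some $n$-folding sequence. A segment is an oriented unit edge of $\mathbb{Z}^2$ (ordered pair $(X,Y)$ of lattice points at distance $1$; its support is the edge $[X,Y]$). A complete curve is a sequence $(C_i)_{i\in\mathbb{Z}}$ of segments such that the terminal point of $C_i$ is the initial point of $C_{i+1}$, consecutive supports are perpendicular, and all supports are pairwise distinct (curves differing by an index shift are identified). Its associated sequence is $(\eta_i)_{i\in\mathbb{Z}}$ with $\eta_i=+1$ (resp. $-1$) if one turns left (resp. right) from $C_i$ to $C_{i+1}$. A complete folding curve is a complete curve whose associated sequence is a complete folding sequence. A covering of $\mathbb{R}^2$ by complete folding curves is a set $\mathcal{C}$ of complete folding curves such that every unit edge of the lattice $\mathbb{Z}^2$ is the support of exactly one segment of exactly one curve of $\mathcal{C}$. A decorated segment of $\mathcal{C}$ is a segment of a curve of $\mathcal{C}$ together with, at each of its endpoints, the support of the segment of the same curve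 which precedes/follows it there. $\mathcal{C}$ satisfies the local isomorphism property if for every finite set $F$ of decorated segments of $\mathcal{C}$ there is $r>0$ such that every disk of radius $r$ in $\mathbb{R}^2$ contains a translate $v+F$ ($v\in\mathbb{Z}^2$) which is a set of decorated segments of $\mathcal{C}$. *)

theory Defs
  imports "HOL-Analysis.Analysis" "HOL-Library.Sublist"
begin

definition fold_bar :: "int list \<Rightarrow> int list" where
  "fold_bar S = map uminus (rev S)"

inductive folding :: "nat \<Rightarrow> int list \<Rightarrow> bool" where
  folding_0: "folding 0 []"
| folding_plus: "folding n S \<Longrightarrow> folding (Suc n) (fold_bar S @ [1] @ S)"
| folding_minus: "folding n S \<Longrightarrow> folding (Suc n) (fold_bar S @ [-1] @ S)"

definition complete_folding_sequence :: "(int \<Rightarrow> int) \<Rightarrow> bool" where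
  "complete_folding_sequence a \<longleftrightarrow>
     (\<forall>k. a k \<in> {1, -1}) \<and>
     (\<forall>i j. \<exists>n S. folding n S \<and> sublist (map a [i..j]) S)"

type_synonym point = "int \<times> int"
type_synonym segment = "point \<times> point"

definition pt :: "point \<Rightarrow> real \<times> real" where
  "pt X = (real_of_int (fst X), real_of_int (snd X))"

definition is_segment :: "segment \<Rightarrow> bool" where
  "is_segment s \<longleftrightarrow> dist (pt (fst s)) (pt (snd s)) = 1"

definition support :: "segment \<Rightarrow> (real \<times> real) set" where
  "support s = closed_segment (pt (fst s)) (pt (snd s))"

definition unit_edges :: "(real \<times> real) set set" where
  "unit_edges = support ` {s. is_segment s}"

definition direction :: "segment \<Rightarrow> int \<times> int" where
  "direction s = snd s - fst s"

definition complete_curve :: "(int \<Rightarrow> segment) \<Rightarrow> bool" where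
  "complete_curve c \<longleftrightarrow>
     (\<forall>i. is_segment (c i)) \<and>
     (\<forall>i. snd (c i) = fst (c (i + 1))) \<and>
     (\<forall>i. orthogonal (pt (direction (c i))) (pt (direction (c (i + 1))))) \<and>
     (\<forall>i j. i \<noteq> j \<longrightarrow> support (c i) \<noteq> support (c j))"

text \<open>
  A turn is to the left iff the determinant of the two directions is positive.
  For perpendicular unit directions the determinant is \<open>1\<close> or \<open>-1\<close>, so the
  \<open>else\<close> branch is exactly the right turn.
\<close>

definition turn :: "segment \<Rightarrow> segment \<Rightarrow> int" where
  "turn s t =
     (let u = direction s; v = direction t
      in if fst u * snd v - snd u * fst v > 0 then 1 else -1)"

definition associated_sequence :: "(int \<Rightarrow> segment) \<Rightarrow> int \<Rightarrow> int" where
  "associated_sequence c i = turn (c i) (c (i + 1))"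

definition complete_folding_curve :: "(int \<Rightarrow> segment) \<Rightarrow> bool" where
  "complete_folding_curve c \<longleftrightarrow>
     complete_curve c \<and> complete_folding_sequence (associated_sequence c)"

text \<open>
  Curves that differ by an index shift are identified: from here on a curve is
  a class of this equivalence relation, i.e. the set of all its
  indexings by the integers.
\<close>

definition index_shift :: "((int \<Rightarrow> segment) \<times> (int \<Rightarrow> segment)) set" where
  "index_shift = {(c, d). \<exists>k. \<forall>i. d i = c (i + k)}"

lemma equiv_index_shift: "equiv UNIV index_shift"
proof (rule equivI)
  show "refl index_shift"
    by (auto simp: refl_on_def index_shift_def intro: exI[of _ 0])
  show "sym index_shift"
  proof (rule symI)
    fix c d assume "(c, d) \<in> index_shift"
    then obtain k where "\<forall>i. d i = c (i + k)" by (auto simp: index_shift_def)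
    then have "\<forall>i. c i = d (i + - k)" by simp
    then show "(d, c) \<in> index_shift" unfolding index_shift_def by blast
  qed
  show "trans index_shift"
  proof (rule transI)
    fix c d e assume "(c, d) \<in> index_shift" "(d, e) \<in> index_shift"
    then obtain k l where "\<forall>i. d i = c (i + k)" "\<forall>i. e i = d (i + l)"
      unfolding index_shift_def by blast
    then have "\<forall>i. e i = c (i + (l + k))" by (simp add: add.assoc)
    then show "(c, e) \<in> index_shift" unfolding index_shift_def by blast
  qed
qed simp

definition complete_folding_curves :: "(int \<Rightarrow> segment) set set" where
  "complete_folding_curves = {c. complete_folding_curve c} // index_shift"

definition segments_of :: "(int \<Rightarrow> segment) set \<Rightarrow> segment set" where
  "segments_of K = (\<Union>c\<in>K. range c)"

definition covering :: "(int \<Rightarrow> segment) set set \<Rightarrow> bool" where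
  "covering \<C> \<longleftrightarrow>
     \<C> \<subseteq> complete_folding_curves \<and>
     (\<forall>e\<in>unit_edges. \<exists>!(K, s). K \<in> \<C> \<and> s \<in> segments_of K \<and> support s = e)"

text \<open>
  A decorated segment is a triple: the support of the preceding segment (attached
  at the initial point), the segment itself, and the support of the following
  segment (attached at the terminal point).
\<close>

type_synonym decorated_segment = "(real \<times> real) set \<times> segment \<times> (real \<times> real) set"

definition decorated_segments :: "(int \<Rightarrow> segment) set set \<Rightarrow> decorated_segment set" where
  "decorated_segments \<C> =
     {(support (c (i - 1)), c i, support (c (i + 1))) | K c i. K \<in> \<C> \<and> c \<in> K}"

definition translate :: "int \<times> int \<Rightarrow> decorated_segment \<Rightarrow> decorated_segment" where
  "translate v = (\<lambda>(p, (X, Y), q). ((+) (pt v) ` p, (v + X, v + Y), (+) (pt v) ` q))"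

definition region :: "decorated_segment \<Rightarrow> (real \<times> real) set" where
  "region = (\<lambda>(p, s, q). p \<union> support s \<union> q)"

definition local_isomorphism_property :: "(int \<Rightarrow> segment) set set \<Rightarrow> bool" where
  "local_isomorphism_property \<C> \<longleftrightarrow>
     (\<forall>F. finite F \<and> F \<subseteq> decorated_segments \<C> \<longrightarrow>
       (\<exists>r>0. \<forall>z. \<exists>v.
          translate v ` F \<subseteq> decorated_segments \<C> \<and>
          (\<Union>d\<in>translate v ` F. region d) \<subseteq> cball z r))"

end

theory Submission
  imports Defs
begin

text \<open>
  At every lattice point the four edges are paired into two corners, so a covering is a
  sign field on \<open>\<int> \<times> \<int>\<close>. In a complete folding sequence every second term alternates; deleting
  these terms replaces a curve by one on a lattice coarser by the factor \<open>sqrt 2\<close>. A single complete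
  folding curve traverses all edges of arbitrarily large discs, so by local isomorphism
  every finite part of the covering looks like a part of one curve. Hence the whole
  covering can be coarsened simultaneously, any number of times.

  Coarsening moves midpoints of edges by at most 1/2 and then shrinks by \<open>sqrt 2\<close>. Finitely
  many curves are therefore all visible, after sufficiently many steps, in a window of 24 edges;
  after three more steps this window has merged into at most six edges, or into at most four
  edges and a vertex star, which carries only two curves.
\<close>

section \<open>Pairing fields and coarsening\<close>

text \<open>The obstacle is that coarsening needs one common choice of retained sublattice and sign.
  Each curve alone admits such a choice, but neighbouring curves could a priori disagree. A copy of
  a finite part inside a disc traversed by one curve inherits that curve's choice; as there are only
  four choices per step, compactness extends it to the plane.

  Curves are counted as labels of edges, which survive coarsening while the edges crowd together.
  The critical radius 1 / (2 * (sqrt 2 - 1)), about 1.207, is the fixed point of the map r -> (r +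
  1/2) / sqrt 2. Above it, this contraction read forwards gathers any finite set of edges; read
  backwards, it inflates one patch to arbitrarily large discs. Rounding the limiting centre to a
  lattice point costs at most sqrt 2 / 2, so radius 2.01 suffices. Doubled midpoints are integer
  vectors, which leaves the 24 edges with midpoints within distance 2 of a vertex.\<close>

definition dirs :: "point set" where
  "dirs = {(1, 0), (0, 1), (-1, 0), (0, -1)}"

definition rot :: "point \<Rightarrow> point" where
  "rot p = (- snd p, fst p)"

definition swp :: "point \<Rightarrow> point" where
  "swp p = (snd p, fst p)"

definition smul :: "int \<Rightarrow> point \<Rightarrow> point" where
  "smul t p = (t * fst p, t * snd p)"

definition sg :: "int \<Rightarrow> int" where
  "sg x = (if even x then 1 else -1)"

text \<open>A half-edge is a lattice point with an outgoing unit vector; \<open>flip\<close> turns it into the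
  other half of the same edge.\<close>

type_synonym halfedge = "point \<times> point"

definition flip :: "halfedge \<Rightarrow> halfedge" where
  "flip h = (fst h + snd h, - snd h)"

text \<open>Identifying points with Gaussian integers, \<open>phi b w = b + (1 + \<i>) * w\<close> enumerates the
  points whose coordinate sum is congruent to \<open>b\<close> modulo 2: the vertices retained by one
  coarsening step. \<open>psi b\<close> is its inverse, meaningful on those points only.\<close>

definition phi :: "int \<Rightarrow> point \<Rightarrow> point" where
  "phi b w = (b + fst w - snd w, fst w + snd w)"

definition psi :: "int \<Rightarrow> point \<Rightarrow> point" where
  "psi b p = ((fst p - b + snd p) div 2, (snd p - fst p + b) div 2)"

text \<open>A field \<open>\<epsilon>\<close> encodes how the edges are paired at each vertex: the edge leaving \<open>P\<close> in
  direction \<open>d\<close> continues, on the same curve, as the one leaving \<open>P\<close> in direction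
  \<open>smul (\<epsilon> P) (swp d)\<close>. If \<open>obeys b s UNIV \<epsilon>\<close>, the arcs through the removed vertices are the edges
  of a coarser lattice; \<open>up b s\<close> sends a half-edge of the coarse lattice to the half-edge from
  which its arc starts, and \<open>deriv_field b s \<epsilon>\<close> is the induced pairing.\<close>

definition deriv_field :: "int \<Rightarrow> int \<Rightarrow> (point \<Rightarrow> int) \<Rightarrow> point \<Rightarrow> int" where
  "deriv_field b s \<epsilon> w = s * sg (fst (phi b w)) * \<epsilon> (phi b w)"

definition up :: "int \<Rightarrow> int \<Rightarrow> halfedge \<Rightarrow> halfedge" where
  "up b s h = (phi b (fst h), if s * sg (fst (phi b (fst h))) = 1 then snd h else rot (snd h))"

definition down_retained :: "int \<Rightarrow> int \<Rightarrow> halfedge \<Rightarrow> halfedge" where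
  "down_retained b s h = (psi b (fst h), if s * sg (fst (fst h)) = 1 then snd h else - rot (snd h))"

definition down :: "int \<Rightarrow> int \<Rightarrow> halfedge \<Rightarrow> halfedge" where
  "down b s h = down_retained b s (if even (fst (fst h) + snd (fst h) + b) then h else flip h)"

definition obeys :: "int \<Rightarrow> int \<Rightarrow> point set \<Rightarrow> (point \<Rightarrow> int) \<Rightarrow> bool" where
  "obeys b s D \<epsilon> \<longleftrightarrow> (\<forall>X\<in>D. odd (fst X + snd X + b) \<longrightarrow> \<epsilon> X = s * sg (fst X))"

text \<open>Relative to a set \<open>D\<close>, so that it can be verified on finite pieces where a
  single curve is available.\<close>

fun layered :: "nat \<Rightarrow> point set \<Rightarrow> (point \<Rightarrow> int) \<Rightarrow> bool" where
  "layered 0 D \<epsilon> = True"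
| "layered (Suc n) D \<epsilon> = (\<exists>b\<in>{0, 1}. \<exists>s\<in>{1, -1}.
     obeys b s D \<epsilon> \<and> layered n (phi b -` D) (deriv_field b s \<epsilon>))"

text \<open>Labels stay the same while fields and edges are replaced, so the counting never has to
  construct coarsened curves.\<close>

definition labelling :: "(point \<Rightarrow> int) \<Rightarrow> (halfedge \<Rightarrow> 'a) \<Rightarrow> bool" where
  "labelling \<epsilon> \<kappa> \<longleftrightarrow> (\<forall>P. \<epsilon> P \<in> {1, -1}) \<and>
     (\<forall>P. \<forall>d\<in>dirs. \<kappa> (flip (P, d)) = \<kappa> (P, d) \<and> \<kappa> (P, smul (\<epsilon> P) (swp d)) = \<kappa> (P, d))"

lemma dirs_cases:
  assumes "d \<in> dirs"
  obtains "d = (1, 0)" | "d = (0, 1)" | "d = (-1, 0)" | "d = (0, -1)"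
  using assms unfolding dirs_def by auto

lemma uminus_dirs [simp]: "- d \<in> dirs \<longleftrightarrow> d \<in> dirs"
  by (cases d) (auto simp: dirs_def)

lemma rot_dirs [simp]: "rot d \<in> dirs \<longleftrightarrow> d \<in> dirs"
  by (cases d) (auto simp: dirs_def rot_def)

lemma swp_dirs [simp]: "swp d \<in> dirs \<longleftrightarrow> d \<in> dirs"
  by (cases d) (auto simp: dirs_def swp_def)

lemma flip_flip [simp]: "flip (flip h) = h"
  by (cases h) (simp add: flip_def prod_eq_iff)

lemma snd_flip [simp]: "snd (flip h) = - snd h"
  by (simp add: flip_def)

lemma sg_values: "sg x \<in> {1, -1}"
  by (simp add: sg_def)

lemma sg_add: "sg (x + y) = sg x * sg y"
  by (auto simp: sg_def)

lemma snd_down_dirs [simp]: "snd (down b s h) \<in> dirs \<longleftrightarrow> snd h \<in> dirs"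
  by (simp add: down_def down_retained_def)

lemma snd_up_dirs [simp]: "snd (up b s h) \<in> dirs \<longleftrightarrow> snd h \<in> dirs"
  by (simp add: up_def)

lemma phi_psi: "even (fst p + snd p + b) \<Longrightarrow> phi b (psi b p) = p"
  by (cases p) (auto simp: phi_def psi_def, presburger+)

lemma up_down_retained:
  "even (fst (fst h) + snd (fst h) + b) \<Longrightarrow> up b s (down_retained b s h) = h"
  by (cases h) (simp add: up_def down_retained_def phi_psi rot_def)

lemma odd_fst_flip:
  assumes "snd h \<in> dirs"
  shows "even (fst (fst (flip h)) + snd (fst (flip h)) + b) \<longleftrightarrow> odd (fst (fst h) + snd (fst h) + b)"
  using assms by (cases h) (auto simp: flip_def dirs_def)

text \<open>Every edge has exactly one retained end, hence equality only up to
  \<open>flip\<close>.\<close>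

lemma up_down:
  assumes "snd h \<in> dirs"
  shows "up b s (down b s h) = h \<or> up b s (down b s h) = flip h"
  using odd_fst_flip[OF assms, of b] by (auto simp: down_def up_down_retained)

lemma labelling_values: "labelling \<epsilon> \<kappa> \<Longrightarrow> \<epsilon> P \<in> {1, -1}"
  unfolding labelling_def by blast

lemma labelling_flip: "labelling \<epsilon> \<kappa> \<Longrightarrow> snd h \<in> dirs \<Longrightarrow> \<kappa> (flip h) = \<kappa> h"
  by (cases h) (auto simp: labelling_def)

lemma labelling_turn:
  "labelling \<epsilon> \<kappa> \<Longrightarrow> d \<in> dirs \<Longrightarrow> \<kappa> (P, smul (\<epsilon> P) (swp d)) = \<kappa> (P, d)"
  unfolding labelling_def by blast

lemma labelling_up_down:
  assumes "labelling \<epsilon> \<kappa>" "snd h \<in> dirs"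
  shows "\<kappa> (up b s (down b s h)) = \<kappa> h"
  using up_down[OF assms(2), of b s] labelling_flip[OF assms] by auto

text \<open>Since (1 + i) v = v + rot v, a coarse edge is the diagonal of a unit square and its arc
  runs along two sides. The sign at the start decides which side comes first. At the far end both
  sign and direction are reversed, so the arc read backwards is again the one selected by
  \<open>up\<close>.\<close>

lemma up_neighbour:
  assumes "v \<in> dirs" "s \<in> {1, -1}"
  shows "let X = phi b w; d = (if s * sg (fst X) = 1 then v else rot v);
      d' = smul (s * sg (fst (X + d))) (swp (- d))
    in (X + d + d', - d') = up b s (w + v, - v)"
proof -
  obtain p q where w: "w = (p, q)" by fastforce
  have sg2: "s = 1 \<and> sg (b + p - q) = 1 \<or> s = 1 \<and> sg (b + p - q) = -1 \<or>
      s = -1 \<and> sg (b + p - q) = 1 \<or> s = -1 \<and> sg (b + p - q) = -1"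
    using assms(2) sg_values[of "b + p - q"] by auto
  have sg1: "sg (x + 1) = - sg x" "sg (x - 1) = - sg x"
    "sg (b + (p + 1) - q) = - sg (b + p - q)" "sg (b + (p - 1) - q) = - sg (b + p - q)"
    "sg (b + p - (q + 1)) = - sg (b + p - q)" "sg (b + p - (q - 1)) = - sg (b + p - q)" for x
    by (auto simp: sg_def)
  show ?thesis
    using assms(1)
    by (elim dirs_cases; insert sg2; elim disjE conjE)
      (simp_all add: Let_def w up_def phi_def smul_def swp_def rot_def sg1)
qed

lemma labelling_deriv:
  assumes lab: "labelling \<epsilon> \<kappa>" and ob: "obeys b s UNIV \<epsilon>" and s: "s \<in> {1, -1}"
  shows "labelling (deriv_field b s \<epsilon>) (\<kappa> \<circ> up b s)"
  unfolding labelling_def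
proof (intro conjI allI ballI)
  fix w
  show "deriv_field b s \<epsilon> w \<in> {1, -1}"
    using labelling_values[OF lab, of "phi b w"] s by (auto simp: deriv_field_def sg_def)
next
  fix w v :: point assume v: "v \<in> dirs"
  define X d where "X = phi b w" and "d = (if s * sg (fst X) = 1 then v else rot v)"
  have d: "d \<in> dirs" using v by (simp add: d_def)
  have up_wv: "up b s (w, v) = (X, d)" by (simp add: up_def X_def d_def)
  have par: "even (fst X + snd X + b)" by (simp add: X_def phi_def)
  have "odd (fst (X + d) + snd (X + d) + b)"
    using odd_fst_flip[of "(X, d)" b] d par by (simp add: flip_def)
  then have e: "\<epsilon> (X + d) = s * sg (fst (X + d))"
    using ob unfolding obeys_def by blast
  define d2 where "d2 = smul (\<epsilon> (X + d)) (swp (- d))"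
  have d2: "d2 \<in> dirs"
    using d s unfolding d2_def e by (auto simp: dirs_def smul_def swp_def sg_def)
  have "\<kappa> (X, d) = \<kappa> (X + d, - d)"
    using labelling_flip[OF lab, of "(X, d)"] d by (simp add: flip_def)
  also have "\<dots> = \<kappa> (X + d, d2)"
    unfolding d2_def using labelling_turn[OF lab, of "- d"] d by simp
  also have "\<dots> = \<kappa> (X + d + d2, - d2)"
    using labelling_flip[OF lab, of "(X + d, d2)"] d2 by (simp add: flip_def)
  also have "(X + d + d2, - d2) = up b s (w + v, - v)"
    unfolding d2_def e unfolding X_def d_def using up_neighbour[OF v s, of b w]
    by (simp only: Let_def)
  finally show "(\<kappa> \<circ> up b s) (flip (w, v)) = (\<kappa> \<circ> up b s) (w, v)"
    by (simp only: comp_def flip_def fst_conv snd_conv up_wv)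
  have eX: "\<epsilon> X \<in> {1, -1}" by (rule labelling_values[OF lab])
  \<comment> \<open>If \<open>up\<close> rotates directions at \<open>X\<close>, a sign appears
    because \<open>swp (rot v) = - rot (swp v)\<close>; the factor in \<open>deriv_field\<close>
    compensates for it.\<close>
  have "up b s (w, smul (deriv_field b s \<epsilon> w) (swp v)) = (X, smul (\<epsilon> X) (swp d))"
    using v s eX unfolding d_def
    by (elim dirs_cases insertE emptyE)
      (simp_all add: up_def X_def deriv_field_def smul_def swp_def rot_def sg_def)
  moreover have "\<kappa> (X, smul (\<epsilon> X) (swp d)) = \<kappa> (X, d)"
    by (rule labelling_turn[OF lab d])
  ultimately show "(\<kappa> \<circ> up b s) (w, smul (deriv_field b s \<epsilon> w) (swp v)) = (\<kappa> \<circ> up b s) (w, v)"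
    by (simp only: comp_def up_wv)
qed

section \<open>Metric control of coarsening\<close>

definition cx :: "point \<Rightarrow> complex" where
  "cx p = Complex (of_int (fst p)) (of_int (snd p))"

definition mid :: "halfedge \<Rightarrow> complex" where
  "mid h = cx (fst h) + cx (snd h) / 2"

definition near :: "complex \<Rightarrow> real \<Rightarrow> halfedge set" where
  "near z r = {h. snd h \<in> dirs \<and> cmod (mid h - z) \<le> r}"

lemma cx_add: "cx (p + q) = cx p + cx q"
  by (simp add: cx_def complex_eq_iff)

lemma cx_minus: "cx (- p) = - cx p"
  by (simp add: cx_def complex_eq_iff)

lemma cx_rot: "cx (rot p) = \<i> * cx p"
  by (simp add: cx_def rot_def complex_eq_iff)

lemma cx_phi: "cx (phi b w) = of_int b + (1 + \<i>) * cx w"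
  by (simp add: cx_def phi_def complex_eq_iff)

lemma mid_flip: "mid (flip h) = mid h"
  by (simp add: mid_def flip_def cx_add cx_minus)

lemma cmod_dirs: "d \<in> dirs \<Longrightarrow> cmod (cx d) = 1"
  by (auto simp: dirs_def cx_def cmod_def)

text \<open>One step of coarsening contracts distances by \<open>sqrt 2\<close> up to an error of \<open>1 / 2\<close>, so edges
  gather within \<open>1 / (2 * (sqrt 2 - 1)) < 5 / 4\<close> of any given centre.\<close>

lemma mid_up_dist:
  assumes "snd h \<in> dirs"
  shows "cmod (mid (up b s h) - (of_int b + (1 + \<i>) * mid h)) = 1 / 2"
proof -
  have "mid (up b s h) - (of_int b + (1 + \<i>) * mid h) =
      (if s * sg (fst (phi b (fst h))) = 1 then - \<i> * cx (snd h) / 2 else - cx (snd h) / 2)"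
    by (simp add: mid_def up_def cx_phi cx_rot complex_eq_iff field_simps)
  then show ?thesis
    using cmod_dirs[OF assms] by (simp add: norm_mult norm_divide)
qed

lemma cmod_one_plus_i: "cmod (1 + \<i>) = sqrt 2"
  by (simp add: cmod_def)

lemma down_near:
  assumes "h \<in> near z r"
  shows "down b s h \<in> near ((z - of_int b) / (1 + \<i>)) ((r + 1 / 2) / sqrt 2)"
proof -
  have h: "snd h \<in> dirs" and hr: "cmod (mid h - z) \<le> r"
    using assms by (auto simp: near_def)
  define m where "m = mid (down b s h)"
  have nz: "1 + \<i> \<noteq> 0" by (simp add: complex_eq_iff)
  have "mid (up b s (down b s h)) = mid h"
    using up_down[OF h, of b s] mid_flip[of h] by auto
  then have "cmod (mid h - (of_int b + (1 + \<i>) * m)) = 1 / 2"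
    using mid_up_dist[of "down b s h" b s] h by (simp add: m_def)
  then have "cmod ((of_int b + (1 + \<i>) * m) - z) \<le> r + 1 / 2"
    using hr norm_triangle_ineq4[of "mid h - z" "mid h - (of_int b + (1 + \<i>) * m)"]
    by (simp add: algebra_simps)
  moreover have "(of_int b + (1 + \<i>) * m) - z = (1 + \<i>) * (m - (z - of_int b) / (1 + \<i>))"
    using nz by (metis diff_diff_eq2 add.commute nonzero_mult_div_cancel_left right_diff_distrib times_divide_eq_right)
  ultimately have "sqrt 2 * cmod (m - (z - of_int b) / (1 + \<i>)) \<le> r + 1 / 2"
    by (simp add: norm_mult cmod_one_plus_i)
  then show ?thesis
    using h by (simp add: near_def m_def field_simps)
qed

lemma contract_labels:
  assumes "labelling \<epsilon> \<kappa>" "layered (n + m) UNIV \<epsilon>" "S \<subseteq> \<kappa> ` near z (5 / 4 + R)" "R \<ge> 0"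
  shows "\<exists>\<epsilon>' (\<kappa>' :: halfedge \<Rightarrow> 'a) z'. labelling \<epsilon>' \<kappa>' \<and> layered m UNIV \<epsilon>' \<and>
     S \<subseteq> \<kappa>' ` near z' (5 / 4 + R / sqrt 2 ^ n)"
  using assms
proof (induction n arbitrary: \<epsilon> \<kappa> z R)
  case 0
  then show ?case by auto
next
  case (Suc n)
  from Suc.prems(2) obtain b s where bs: "s \<in> {1, -1}" "obeys b s UNIV \<epsilon>"
      "layered (n + m) UNIV (deriv_field b s \<epsilon>)"
    by auto
  have lab: "labelling (deriv_field b s \<epsilon>) (\<kappa> \<circ> up b s)"
    by (rule labelling_deriv[OF Suc.prems(1) bs(2) bs(1)])
  define z' where "z' = (z - of_int b) / (1 + \<i>)"
  \<comment> \<open>The bound 7/5 for sqrt 2 is just enough: 5/4 * 7/5 = 7/4 = 5/4 + 1/2.\<close>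
  have r: "(5 / 4 + R + 1 / 2) / sqrt 2 \<le> 5 / 4 + R / sqrt 2"
  proof -
    have "(7 / 5 :: real) \<le> sqrt 2" by (rule real_le_rsqrt) (simp add: power2_eq_square)
    then show ?thesis by (simp add: field_simps)
  qed
  have "S \<subseteq> (\<kappa> \<circ> up b s) ` near z' (5 / 4 + R / sqrt 2)"
  proof
    fix x assume "x \<in> S"
    then obtain h where h: "h \<in> near z (5 / 4 + R)" "x = \<kappa> h" using Suc.prems(3) by auto
    have "down b s h \<in> near z' (5 / 4 + R / sqrt 2)"
      using down_near[OF h(1), of b s] r by (auto simp: near_def z'_def)
    moreover have "x = (\<kappa> \<circ> up b s) (down b s h)"
      using labelling_up_down[OF Suc.prems(1)] h by (simp add: near_def)
    ultimately show "x \<in> (\<kappa> \<circ> up b s) ` near z' (5 / 4 + R / sqrt 2)" by blast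
  qed
  moreover have "R / sqrt 2 / sqrt 2 ^ n = R / sqrt 2 ^ Suc n" by simp
  moreover have "R / sqrt 2 \<ge> 0" using Suc.prems(4) by simp
  ultimately show ?case using Suc.IH[OF lab bs(3)] by metis
qed

section \<open>Invariance under translation\<close>

definition shift_field :: "point \<Rightarrow> (point \<Rightarrow> int) \<Rightarrow> point \<Rightarrow> int" where
  "shift_field p \<epsilon> X = \<epsilon> (p + X)"

text \<open>Translation by \<open>p\<close> changes the parity \<open>b\<close> by that of
  \<open>p\<close> and the sign by \<open>sg (fst p)\<close>, and it translates the coarse field by
  \<open>q\<close>, so the same argument recurs at every level.\<close>

lemma layered_shift:
  "layered n UNIV \<epsilon> \<Longrightarrow> layered n UNIV (shift_field p \<epsilon>)"
proof (induction n arbitrary: \<epsilon> p)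
  case 0
  then show ?case by simp
next
  case (Suc n)
  from Suc.prems obtain b s where bs: "b \<in> {0, 1}" "s \<in> {1, -1}" "obeys b s UNIV \<epsilon>"
      "layered n UNIV (deriv_field b s \<epsilon>)"
    by auto
  define b' s' where "b' = (b + fst p + snd p) mod 2" and "s' = s * sg (fst p)"
  \<comment> \<open>\<open>b'\<close> is chosen to make \<open>p + (b', 0)\<close> a retained vertex
    for \<open>b\<close>; it is the coarse origin of the shifted lattice.\<close>
  define q where "q = psi b (p + (b', 0))"
  have ev: "even (b' + b + fst p + snd p)" unfolding b'_def by presburger
  have q: "phi b q = p + (b', 0)"
    unfolding q_def by (rule phi_psi) (use ev in \<open>simp add: algebra_simps\<close>)
  have ph: "p + phi b' w = phi b (q + w)" for w
    using q by (simp add: phi_def prod_eq_iff)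
  have "obeys b' s' UNIV (shift_field p \<epsilon>)"
    unfolding obeys_def shift_field_def
  proof (intro ballI impI)
    fix X :: point assume "odd (fst X + snd X + b')"
    then have "odd (fst (p + X) + snd (p + X) + b)" using ev by auto
    then have "\<epsilon> (p + X) = s * sg (fst (p + X))" using bs(3) unfolding obeys_def by blast
    then show "\<epsilon> (p + X) = s' * sg (fst X)" by (simp add: s'_def sg_add)
  qed
  moreover have "deriv_field b' s' (shift_field p \<epsilon>) = shift_field q (deriv_field b s \<epsilon>)"
  proof
    fix w
    have "fst (phi b (q + w)) = fst p + fst (phi b' w)" by (simp flip: ph)
    then show "deriv_field b' s' (shift_field p \<epsilon>) w = shift_field q (deriv_field b s \<epsilon>) w"
      by (simp add: deriv_field_def shift_field_def ph s'_def sg_add mult.assoc)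
  qed
  moreover have "b' \<in> {0, 1}" unfolding b'_def by auto
  moreover have "s' \<in> {1, -1}" using bs(2) by (auto simp: s'_def sg_def)
  ultimately show ?case
    unfolding layered.simps vimage_UNIV using Suc.IH[OF bs(4), of q] by metis
qed

lemma labelling_shift:
  assumes "labelling \<epsilon> \<kappa>"
  shows "labelling (shift_field p \<epsilon>) (\<lambda>h. \<kappa> (p + fst h, snd h))"
  using assms unfolding labelling_def shift_field_def flip_def fst_conv snd_conv
  by (simp only: add.assoc[symmetric]) blast

section \<open>Counting the labels of an infinitely coarsenable field\<close>

text \<open>The half pointing right or up is chosen, so that \<open>remdups\<close> detects when two
  edges have merged.\<close>

definition normal_form :: "halfedge \<Rightarrow> halfedge" where
  "normal_form h = (if fst (snd h) + snd (snd h) < 0 then flip h else h)"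

definition edge_step :: "int \<Rightarrow> int \<Rightarrow> halfedge list \<Rightarrow> halfedge list" where
  "edge_step b s E = remdups (map (\<lambda>h. normal_form (down b s h)) E)"

definition window :: "halfedge list" where
  "window = filter (\<lambda>(P, d). (2 * fst P + fst d)\<^sup>2 + (2 * snd P + snd d)\<^sup>2 \<le> 16)
     (List.product (List.product [-2..2] [-2..2]) [(1, 0), (0, 1)])"

definition star :: "point \<Rightarrow> halfedge list" where
  "star v = [(v, (1, 0)), (v, (0, 1)), (v - (1, 0), (1, 0)), (v - (0, 1), (0, 1))]"

text \<open>The four edges at a vertex carry at most two labels, since they are paired there.\<close>

definition few :: "halfedge list \<Rightarrow> bool" where
  "few E \<longleftrightarrow> length E \<le> 6 \<or>
     list_ex (\<lambda>h. length (filter (\<lambda>g. g \<notin> set (star (fst h))) E) \<le> 4) E"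

text \<open>Exhaustive check over the 64 possible choices of three consecutive coarsening steps.\<close>

lemma few_edge_step3:
  "list_all (\<lambda>b1. list_all (\<lambda>s1. list_all (\<lambda>b2. list_all (\<lambda>s2. list_all (\<lambda>b3. list_all (\<lambda>s3.
     few (edge_step b3 s3 (edge_step b2 s2 (edge_step b1 s1 window))))
     [1, -1]) [0, 1]) [1, -1]) [0, 1]) [1, -1]) [0, 1]"
  by code_simp

lemma snd_normal_form_dirs [simp]: "snd (normal_form h) \<in> dirs \<longleftrightarrow> snd h \<in> dirs"
  by (simp add: normal_form_def)

lemma labelling_normal_form:
  "labelling \<epsilon> \<kappa> \<Longrightarrow> snd h \<in> dirs \<Longrightarrow> \<kappa> (normal_form h) = \<kappa> h"
  by (simp add: normal_form_def labelling_flip)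

text \<open>Whatever the sign at \<open>v\<close>, each vertical half-edge is paired with a
  horizontal one.\<close>

lemma star_labels:
  assumes "labelling \<epsilon> \<kappa>"
  shows "\<kappa> ` set (star v) \<subseteq> {\<kappa> (v, (1, 0)), \<kappa> (v, (-1, 0))}"
proof -
  have turn: "\<kappa> (v, smul (\<epsilon> v) (swp d)) = \<kappa> (v, d)" if "d \<in> dirs" for d
    using assms that by (rule labelling_turn)
  have fl: "\<kappa> (flip (v, d)) = \<kappa> (v, d)" if "d \<in> dirs" for d
    using assms that by (simp add: labelling_flip)
  have "flip (v, (-1, 0)) = (v - (1, 0), (1, 0))" "flip (v, (0, -1)) = (v - (0, 1), (0, 1))"
    by (simp_all add: flip_def prod_eq_iff)
  then have "\<kappa> (v - (1, 0), (1, 0)) = \<kappa> (v, (-1, 0))" "\<kappa> (v - (0, 1), (0, 1)) = \<kappa> (v, (0, -1))"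
    using fl[of "(-1, 0)"] fl[of "(0, -1)"] by (simp_all add: dirs_def)
  moreover have "\<epsilon> v = 1 \<or> \<epsilon> v = -1" using labelling_values[OF assms, of v] by simp
  ultimately show ?thesis
    using turn[of "(0, 1)"] turn[of "(0, -1)"]
    by (auto simp: star_def smul_def swp_def dirs_def)
qed

lemma few_labels:
  assumes "labelling \<epsilon> \<kappa>" "few E"
  shows "card (\<kappa> ` set E) \<le> 6"
proof (cases "length E \<le> 6")
  case True
  then show ?thesis
    by (meson List.finite_set card_image_le card_length le_trans)
next
  case False
  then obtain v where v: "length (filter (\<lambda>g. g \<notin> set (star v)) E) \<le> 4"
    using assms(2) by (auto simp: few_def list_ex_iff)
  let ?F = "filter (\<lambda>g. g \<notin> set (star v)) E"
  let ?L = "{\<kappa> (v, (1, 0)), \<kappa> (v, (-1, 0))}"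
  have "\<kappa> ` set E \<subseteq> \<kappa> ` set ?F \<union> ?L"
    using star_labels[OF assms(1), of v] by auto
  then have "card (\<kappa> ` set E) \<le> card (\<kappa> ` set ?F \<union> ?L)"
    by (intro card_mono) auto
  also have "\<dots> \<le> card (\<kappa> ` set ?F) + card ?L" by (rule card_Un_le)
  also have "card (\<kappa> ` set ?F) \<le> 4"
    using v by (meson List.finite_set card_image_le card_length le_trans)
  also have "card ?L \<le> 2" by (simp add: card_insert_if)
  finally show ?thesis by simp
qed

lemma edge_step_dirs: "snd ` set E \<subseteq> dirs \<Longrightarrow> snd ` set (edge_step b s E) \<subseteq> dirs"
  by (auto simp: edge_step_def)

lemma edge_step_labels:
  assumes "labelling \<epsilon> \<kappa>" "labelling \<epsilon>' (\<kappa> \<circ> up b s)" "snd ` set E \<subseteq> dirs"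
  shows "\<kappa> ` set E \<subseteq> (\<kappa> \<circ> up b s) ` set (edge_step b s E)"
proof (rule image_subsetI)
  fix h assume h: "h \<in> set E"
  then have d: "snd h \<in> dirs" using assms(3) by auto
  have "(\<kappa> \<circ> up b s) (normal_form (down b s h)) = \<kappa> h"
    using labelling_normal_form[OF assms(2), of "down b s h"] labelling_up_down[OF assms(1) d] d
    by simp
  moreover have "normal_form (down b s h) \<in> set (edge_step b s E)"
    using h by (simp add: edge_step_def)
  ultimately show "\<kappa> h \<in> (\<kappa> \<circ> up b s) ` set (edge_step b s E)"
    by (metis imageI)
qed

lemma layered_step:
  assumes "labelling \<epsilon> \<kappa>" "layered (Suc n) UNIV \<epsilon>" "snd ` set E \<subseteq> dirs"
  obtains b s where "b \<in> set [0, 1]" "s \<in> set [1, -1]"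
    "labelling (deriv_field b s \<epsilon>) (\<kappa> \<circ> up b s)" "layered n UNIV (deriv_field b s \<epsilon>)"
    "\<kappa> ` set E \<subseteq> (\<kappa> \<circ> up b s) ` set (edge_step b s E)" "snd ` set (edge_step b s E) \<subseteq> dirs"
proof -
  from assms(2) obtain b s where bs: "b \<in> {0, 1}" "s \<in> {1, -1}" "obeys b s UNIV \<epsilon>"
      "layered n UNIV (deriv_field b s \<epsilon>)"
    by auto
  have lab: "labelling (deriv_field b s \<epsilon>) (\<kappa> \<circ> up b s)"
    by (rule labelling_deriv[OF assms(1) bs(3) bs(2)])
  show thesis
    using that[of b s] bs lab edge_step_labels[OF assms(1) lab assms(3)] edge_step_dirs[OF assms(3)] by simp
qed

lemma window_dirs: "snd ` set window \<subseteq> dirs"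
  by (auto simp: window_def dirs_def)

lemma window_labels:
  assumes "labelling \<epsilon> \<kappa>" "layered 3 UNIV \<epsilon>"
  shows "card (\<kappa> ` set window) \<le> 6"
proof -
  have "layered (Suc (Suc (Suc 0))) UNIV \<epsilon>" using assms(2) by (simp add: numeral_3_eq_3)
  from layered_step[OF assms(1) this window_dirs] obtain b1 s1 where 1:
    "b1 \<in> set [0, 1]" "s1 \<in> set [1, -1]"
    "labelling (deriv_field b1 s1 \<epsilon>) (\<kappa> \<circ> up b1 s1)"
    "layered (Suc (Suc 0)) UNIV (deriv_field b1 s1 \<epsilon>)"
    "\<kappa> ` set window \<subseteq> (\<kappa> \<circ> up b1 s1) ` set (edge_step b1 s1 window)"
    "snd ` set (edge_step b1 s1 window) \<subseteq> dirs" .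
  define \<epsilon>1 \<kappa>1 E1 where "\<epsilon>1 = deriv_field b1 s1 \<epsilon>" and "\<kappa>1 = \<kappa> \<circ> up b1 s1"
    and "E1 = edge_step b1 s1 window"
  note 1 = 1[folded \<epsilon>1_def \<kappa>1_def E1_def]
  from layered_step[OF 1(3,4,6)] obtain b2 s2 where 2:
    "b2 \<in> set [0, 1]" "s2 \<in> set [1, -1]"
    "labelling (deriv_field b2 s2 \<epsilon>1) (\<kappa>1 \<circ> up b2 s2)"
    "layered (Suc 0) UNIV (deriv_field b2 s2 \<epsilon>1)"
    "\<kappa>1 ` set E1 \<subseteq> (\<kappa>1 \<circ> up b2 s2) ` set (edge_step b2 s2 E1)"
    "snd ` set (edge_step b2 s2 E1) \<subseteq> dirs" .
  define \<epsilon>2 \<kappa>2 E2 where "\<epsilon>2 = deriv_field b2 s2 \<epsilon>1" and "\<kappa>2 = \<kappa>1 \<circ> up b2 s2"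
    and "E2 = edge_step b2 s2 E1"
  note 2 = 2[folded \<epsilon>2_def \<kappa>2_def E2_def]
  from layered_step[OF 2(3,4,6)] obtain b3 s3 where 3:
    "b3 \<in> set [0, 1]" "s3 \<in> set [1, -1]"
    "labelling (deriv_field b3 s3 \<epsilon>2) (\<kappa>2 \<circ> up b3 s3)"
    "\<kappa>2 ` set E2 \<subseteq> (\<kappa>2 \<circ> up b3 s3) ` set (edge_step b3 s3 E2)" by metis
  have "few (edge_step b3 s3 E2)"
    using few_edge_step3 1(1,2) 2(1,2) 3(1,2) unfolding list_all_iff E2_def E1_def by blast
  then have "card ((\<kappa>2 \<circ> up b3 s3) ` set (edge_step b3 s3 E2)) \<le> 6"
    by (rule few_labels[OF 3(3)])
  moreover have "card (\<kappa> ` set window) \<le> card ((\<kappa>2 \<circ> up b3 s3) ` set (edge_step b3 s3 E2))"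
    using 1(5) 2(5) 3(4) by (intro card_mono) auto
  ultimately show ?thesis by simp
qed

lemma near_window:
  assumes "h \<in> near 0 (201 / 100)"
  shows "normal_form h \<in> set window"
proof -
  obtain P d where nf: "normal_form h = (P, d)" by (cases "normal_form h")
  have hd: "snd h \<in> dirs" and hm: "cmod (mid h) \<le> 201 / 100"
    using assms by (auto simp: near_def)
  have d: "d \<in> {(1, 0), (0, 1)}"
    using hd nf by (cases h) (auto simp: normal_form_def dirs_def flip_def)
  have "mid (P, d) = mid h"
    using nf mid_flip[of h] by (auto simp: normal_form_def split: if_splits)
  define x y where "x = 2 * fst P + fst d" and "y = 2 * snd P + snd d"
  have "2 * mid (P, d) = Complex (of_int x) (of_int y)"
    by (simp add: mid_def cx_def complex_eq_iff x_def y_def)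
  then have "cmod (Complex (of_int x) (of_int y)) = 2 * cmod (mid h)"
    using \<open>mid (P, d) = mid h\<close> by (metis norm_mult norm_numeral)
  then have "sqrt (real_of_int (x\<^sup>2 + y\<^sup>2)) \<le> 402 / 100"
    using hm by (simp add: complex_norm)
  then have "real_of_int (x\<^sup>2 + y\<^sup>2) \<le> (402 / 100)\<^sup>2"
    by (rule sqrt_le_D)
  \<comment> \<open>(402/100)^2 = 16.1604, and the sum is an integer, so the slack beyond radius 2
    admits no further edge.\<close>
  then have "real_of_int (x\<^sup>2 + y\<^sup>2) < 17"
    by (simp add: power2_eq_square)
  then have le: "x\<^sup>2 + y\<^sup>2 \<le> 16" by linarith
  have bnd: "\<bar>z\<bar> \<le> 4" if "z\<^sup>2 \<le> 16" for z :: int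
    using that abs_le_square_iff[of z 4] by simp
  have "\<bar>x\<bar> \<le> 4" "\<bar>y\<bar> \<le> 4"
    using le by (auto intro!: bnd) (smt (verit) zero_le_power2)+
  then have "fst P \<in> {-2..2}" "snd P \<in> {-2..2}"
    using d by (auto simp: x_def y_def)
  then show ?thesis
    using d le unfolding nf window_def set_filter set_product set_upto
    by (cases P) (auto simp: x_def y_def)
qed

lemma near_vertex: "\<exists>p. cmod (z - cx p) \<le> 71 / 100"
proof -
  define p where "p = (round (Re z), round (Im z))"
  have "\<bar>Re (z - cx p)\<bar> \<le> 1 / 2" "\<bar>Im (z - cx p)\<bar> \<le> 1 / 2"
    using of_int_round_abs_le[of "Re z"] of_int_round_abs_le[of "Im z"]
    by (auto simp: p_def cx_def abs_minus_commute)
  then have "(Re (z - cx p))\<^sup>2 \<le> (1 / 2)\<^sup>2" "(Im (z - cx p))\<^sup>2 \<le> (1 / 2)\<^sup>2"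
    by (metis abs_ge_zero power2_abs power_mono)+
  then have "(Re (z - cx p))\<^sup>2 + (Im (z - cx p))\<^sup>2 \<le> (71 / 100)\<^sup>2"
    by (simp add: power2_eq_square)
  then show ?thesis
    unfolding cmod_def by (intro exI[of _ p] real_le_lsqrt) auto
qed

theorem layered_labels_le_6:
  assumes lab: "labelling \<epsilon> \<kappa>" and lay: "\<And>n. layered n UNIV \<epsilon>"
  shows "finite (\<kappa> ` {h. snd h \<in> dirs}) \<and> card (\<kappa> ` {h. snd h \<in> dirs}) \<le> 6"
proof (rule finite_if_finite_subsets_card_bdd)
  fix S assume S: "S \<subseteq> \<kappa> ` {h. snd h \<in> dirs}" "finite S"
  then obtain H where H: "H \<subseteq> {h. snd h \<in> dirs}" "finite H" "S = \<kappa> ` H"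
    by (meson finite_subset_image)
  define R where "R = (\<Sum>h\<in>H. cmod (mid h))"
  have R0: "R \<ge> 0" unfolding R_def by (simp add: sum_nonneg)
  have "H \<subseteq> near 0 (5 / 4 + R)"
  proof
    fix h assume h: "h \<in> H"
    then have "cmod (mid h) \<le> R"
      unfolding R_def using H(2) by (intro member_le_sum) auto
    then show "h \<in> near 0 (5 / 4 + R)" using h H(1) by (auto simp: near_def)
  qed
  then have SR: "S \<subseteq> \<kappa> ` near 0 (5 / 4 + R)" using H(3) by auto
  \<comment> \<open>The excess becomes at most 1/20, and 5/4 + 71/100 + 1/20 = 201/100, where 71/100
    is just above sqrt 2 / 2.\<close>
  obtain n where n: "R * 20 < sqrt 2 ^ n"
    using real_arch_pow[of "sqrt 2" "R * 20"] by auto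
  obtain \<epsilon>' and \<kappa>' :: "halfedge \<Rightarrow> 'a" and z where c: "labelling \<epsilon>' \<kappa>'" "layered 3 UNIV \<epsilon>'"
      "S \<subseteq> \<kappa>' ` near z (5 / 4 + R / sqrt 2 ^ n)"
    using contract_labels[OF lab lay SR R0, of 3 n] by blast
  have "R / sqrt 2 ^ n \<le> 1 / 20" using n by (simp add: field_simps)
  obtain p where p: "cmod (z - cx p) \<le> 71 / 100" using near_vertex by blast
  let ?\<kappa> = "\<lambda>h. \<kappa>' (p + fst h, snd h)"
  have lab': "labelling (shift_field p \<epsilon>') ?\<kappa>" by (rule labelling_shift[OF c(1)])
  have "S \<subseteq> ?\<kappa> ` set window"
  proof
    fix x assume "x \<in> S"
    then obtain h where h: "h \<in> near z (5 / 4 + R / sqrt 2 ^ n)" "x = \<kappa>' h" using c(3) by blast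
    define g where "g = (fst h - p, snd h)"
    have "mid g = (mid h - z) + (z - cx p)"
      using cx_add[of "fst h" "- p"] cx_minus[of p] by (simp add: g_def mid_def)
    then have "cmod (mid g) \<le> cmod (mid h - z) + cmod (z - cx p)"
      by (metis norm_triangle_ineq)
    moreover have "cmod (mid h - z) \<le> 5 / 4 + R / sqrt 2 ^ n" using h(1) by (simp add: near_def)
    ultimately have "cmod (mid g) \<le> 201 / 100"
      using p \<open>R / sqrt 2 ^ n \<le> 1 / 20\<close> by linarith
    then have "g \<in> near 0 (201 / 100)" using h(1) by (simp add: near_def g_def)
    then have g: "normal_form g \<in> set window" by (rule near_window)
    have "x = ?\<kappa> (normal_form g)"
      using labelling_normal_form[OF lab', of g] h by (simp add: g_def near_def)
    then show "x \<in> ?\<kappa> ` set window" using g by (rule image_eqI)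
  qed
  then have "card S \<le> card (?\<kappa> ` set window)" by (intro card_mono) auto
  also have "\<dots> \<le> 6"
    by (rule window_labels[OF lab' layered_shift[OF c(2)]])
  finally show "card S \<le> 6" .
qed

section \<open>Folding sequences and folding paths\<close>

text \<open>Every folding sequence arises from one of the previous level by inserting alternating signs.\<close>

fun interl :: "int \<Rightarrow> int list \<Rightarrow> int list" where
  "interl s [] = [s]"
| "interl s (d # D) = s # d # interl (- s) D"

lemma length_interl [simp]: "length (interl s D) = 2 * length D + 1"
  by (induction D arbitrary: s) auto

lemma interl_append:
  "interl s (D @ e # D') = interl s D @ e # interl (s * (- 1) ^ Suc (length D)) D'"
  by (induction D arbitrary: s) auto

text \<open>The last inserted sign is \<open>s * (- 1) ^ length D\<close>; reversal and negation put
  its negative first and keep the alternation.\<close>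

lemma fold_bar_interl:
  "fold_bar (interl s D) = interl (- s * (- 1) ^ length D) (fold_bar D)"
proof (induction D arbitrary: s)
  case Nil
  then show ?case by (simp add: fold_bar_def)
next
  case (Cons d D)
  have sq: "s * (- 1) ^ length D * (- 1) ^ length D = s"
    by (simp add: mult.assoc flip: power_add mult_2)
  have "fold_bar (interl s (d # D)) = fold_bar (interl (- s) D) @ [- d, - s]"
    by (simp add: fold_bar_def)
  also have "\<dots> = interl (s * (- 1) ^ length D) (fold_bar D) @ [- d, - s]"
    by (simp add: Cons.IH)
  also have "\<dots> = interl (s * (- 1) ^ length D) (fold_bar D @ [- d])"
    using sq by (simp add: interl_append fold_bar_def)
  finally show ?case by (simp add: fold_bar_def)
qed

lemma nth_interl_even: "j \<le> length D \<Longrightarrow> interl s D ! (2 * j) = s * (- 1) ^ j"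
proof (induction D arbitrary: s j)
  case (Cons d D)
  then show ?case by (cases j) auto
qed auto

lemma nth_interl_odd: "j < length D \<Longrightarrow> interl s D ! (2 * j + 1) = D ! j"
proof (induction D arbitrary: s j)
  case (Cons d D)
  then show ?case by (cases j) auto
qed auto

lemma length_folding: "folding n S \<Longrightarrow> length S + 1 = 2 ^ n"
  by (induction rule: folding.induct) (auto simp: fold_bar_def)

lemma folding_Suc: "folding n S \<Longrightarrow> e \<in> {1, -1} \<Longrightarrow> folding (Suc n) (fold_bar S @ e # S)"
  using folding_plus[of n S] folding_minus[of n S] by auto

text \<open>For m > 0 the length 2^m - 1 of \<open>D\<close> is odd, so the alternation continues
  across \<open>e\<close>, which becomes the central term of the coarse sequence. For m = 0 the
  leading sign flips instead, hence the separate case.\<close>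

lemma folding_interl_step:
  assumes "folding m D" "s \<in> {1, -1}" "e \<in> {1, -1}"
  shows "\<exists>s' D'. folding (Suc m) D' \<and> s' \<in> {1, -1} \<and>
     fold_bar (interl s D) @ e # interl s D = interl s' D'"
proof (cases m)
  case 0
  then have "D = []" using length_folding[OF assms(1)] by simp
  moreover have "folding (Suc 0) [e]" using folding_Suc[OF folding_0 assms(3)] by (simp add: fold_bar_def)
  ultimately show ?thesis
    using assms(2) 0 by (intro exI[of _ "- s"] exI[of _ "[e]"]) (auto simp: fold_bar_def)
next
  case (Suc k)
  have "length D + 1 = 2 * 2 ^ k" using length_folding[OF assms(1)] Suc by simp
  then have "odd (length D)" by presburger
  then have "fold_bar (interl s D) @ e # interl s D = interl s (fold_bar D @ e # D)"
    by (simp add: fold_bar_interl interl_append) (simp add: fold_bar_def)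
  then show ?thesis using folding_Suc[OF assms(1,3)] assms(2) by blast
qed

lemma folding_interl:
  "folding n S \<Longrightarrow> 0 < n \<Longrightarrow> \<exists>m s D. folding m D \<and> n = Suc m \<and> s \<in> {1, -1} \<and> S = interl s D"
proof (induction rule: folding.induct)
  case folding_0
  then show ?case by simp
next
  case (folding_plus n S)
  show ?case
  proof (cases "n = 0")
    case True
    then have "S = []" using length_folding[OF folding_plus(1)] by simp
    then show ?thesis
      using True folding_0 by (intro exI[of _ 0] exI[of _ 1] exI[of _ "[]"]) (auto simp: fold_bar_def)
  next
    case False
    then obtain m s D where "folding m D" "n = Suc m" "s \<in> {1, -1}" "S = interl s D"
      using folding_plus by blast
    then show ?thesis using folding_interl_step[of m D s 1] by auto
  qed
next
  case (folding_minus n S)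
  show ?case
  proof (cases "n = 0")
    case True
    then have "S = []" using length_folding[OF folding_minus(1)] by simp
    then show ?thesis
      using True folding_0 by (intro exI[of _ 0] exI[of _ "-1"] exI[of _ "[]"]) (auto simp: fold_bar_def)
  next
    case False
    then obtain m s D where "folding m D" "n = Suc m" "s \<in> {1, -1}" "S = interl s D"
      using folding_minus by blast
    then show ?thesis using folding_interl_step[of m D s "-1"] by auto
  qed
qed

lemma neg_one_power_nat: "0 \<le> x \<Longrightarrow> (- 1) ^ nat x = sg x"
  by (auto simp: sg_def even_nat_iff)

text \<open>What one finite subword can certify about \<open>t\<close>; \<open>c\<close> and
  \<open>s\<close> may still depend on \<open>N\<close>.\<close>

definition folds_up_to :: "(int \<Rightarrow> int) \<Rightarrow> int \<Rightarrow> int \<Rightarrow> nat \<Rightarrow> bool" where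
  "folds_up_to t c s N \<longleftrightarrow>
     (\<forall>j. \<bar>2 * j + c\<bar> \<le> int N \<longrightarrow> t (2 * j + c) = s * sg j) \<and>
     (\<forall>i k. \<bar>2 * i + c + 1\<bar> \<le> int N \<and> \<bar>2 * k + c + 1\<bar> \<le> int N \<longrightarrow>
        (\<exists>n S. folding n S \<and> sublist (map (\<lambda>j. t (2 * j + c + 1)) [i..k]) S))"

lemma folds_up_to_mono: "folds_up_to t c s M \<Longrightarrow> N \<le> M \<Longrightarrow> folds_up_to t c s N"
  unfolding folds_up_to_def by (meson dual_order.trans of_nat_le_iff)

lemma ex_folds_up_to:
  assumes "complete_folding_sequence t"
  shows "\<exists>c\<in>{0, 1}. \<exists>s\<in>{1, -1}. folds_up_to t c s N"
proof -
  obtain n S where S: "folding n S" "sublist (map t [- int N..int N]) S"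
    using assms unfolding complete_folding_sequence_def by blast
  then obtain P Q where PQ: "S = P @ map t [- int N..int N] @ Q" by (auto simp: sublist_def)
  have "n \<noteq> 0"
  proof
    assume "n = 0"
    then have "S = []" using length_folding[OF S(1)] by simp
    then show False using PQ by simp
  qed
  then obtain m s D where D: "folding m D" "s \<in> {1, -1}" "S = interl s D"
    using folding_interl[OF S(1)] by blast
  \<comment> \<open>Index \<open>k\<close> of \<open>t\<close> is position \<open>k + a\<close> of
    \<open>S\<close>. Inserted signs sit at even positions, which is why \<open>c\<close> below is
    the parity of \<open>a\<close>.\<close>
  define a where "a = int N + int (length P)"
  have tS: "t k = S ! nat (k + a)" and kl: "0 \<le> k + a" "k + a < 2 * int (length D) + 1"
    if "\<bar>k\<bar> \<le> int N" for k
  proof -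
    have "nat (k + a) = length P + nat (k + int N)" using that by (simp add: a_def)
    then show "t k = S ! nat (k + a)"
      unfolding PQ using abs_le_D1[OF that] abs_le_D2[OF that] by (simp add: nth_append)
    show "0 \<le> k + a" using that by (simp add: a_def)
    have "length S = length P + (2 * N + 1) + length Q" unfolding PQ by simp
    then show "k + a < 2 * int (length D) + 1" using that D(3) by (simp add: a_def)
  qed
  define c where "c = a mod 2"
  define h where "h = (c + a) div 2"
  have ch: "c + a = 2 * h" unfolding h_def c_def by presburger
  have "folds_up_to t c (s * sg h) N"
    unfolding folds_up_to_def
  proof (intro conjI allI impI)
    fix j assume j: "\<bar>2 * j + c\<bar> \<le> int N"
    have e: "2 * j + c + a = 2 * (j + h)" using ch by simp
    have b: "0 \<le> j + h" "nat (j + h) \<le> length D" using kl[OF j] unfolding e by auto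
    have "nat (2 * (j + h)) = 2 * nat (j + h)" using b(1) by simp
    then have "t (2 * j + c) = S ! (2 * nat (j + h))" using tS[OF j] unfolding e by simp
    also have "\<dots> = s * sg (j + h)"
      unfolding D(3) using nth_interl_even[OF b(2)] neg_one_power_nat[OF b(1)] by simp
    finally show "t (2 * j + c) = s * sg h * sg j" by (simp add: sg_add)
  next
    fix i k assume ik: "\<bar>2 * i + c + 1\<bar> \<le> int N \<and> \<bar>2 * k + c + 1\<bar> \<le> int N"
    have tD: "t (2 * j + c + 1) = D ! nat (j + h)" and jl: "0 \<le> j + h" "nat (j + h) < length D"
      if "\<bar>2 * j + c + 1\<bar> \<le> int N" for j
    proof -
      have e: "2 * j + c + 1 + a = 2 * (j + h) + 1" using ch by simp
      show b: "0 \<le> j + h" "nat (j + h) < length D" using kl[OF that] unfolding e by auto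
      have "nat (2 * (j + h) + 1) = 2 * nat (j + h) + 1" using b(1) by simp
      then have "t (2 * j + c + 1) = S ! (2 * nat (j + h) + 1)"
        using tS[OF that] unfolding e by simp
      then show "t (2 * j + c + 1) = D ! nat (j + h)"
        unfolding D(3) using nth_interl_odd[OF b(2)] by simp
    qed
    have "sublist (map (\<lambda>j. t (2 * j + c + 1)) [i..k]) D"
    proof (cases "i \<le> k")
      case True
      have bi: "0 \<le> i + h" and bk: "nat (k + h) < length D" using jl ik by auto
      have "map (\<lambda>j. t (2 * j + c + 1)) [i..k] = take (nat (k - i + 1)) (drop (nat (i + h)) D)"
      proof (rule nth_equalityI)
        show "length (map (\<lambda>j. t (2 * j + c + 1)) [i..k])
            = length (take (nat (k - i + 1)) (drop (nat (i + h)) D))"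
          using True bi bk by (simp add: min_def) linarith
        fix l assume "l < length (map (\<lambda>j. t (2 * j + c + 1)) [i..k])"
        then have l: "int l \<le> k - i" by simp
        then have "2 * i \<le> 2 * (i + int l)" "2 * (i + int l) \<le> 2 * k" by simp_all
        then have "\<bar>2 * (i + int l) + c + 1\<bar> \<le> int N" using ik by (elim conjE) linarith
        note tD[OF this]
        moreover have "[i..k] ! l = i + int l" using l by (intro nth_upto) simp
        ultimately have "map (\<lambda>j. t (2 * j + c + 1)) [i..k] ! l = D ! nat (i + int l + h)"
          using l by simp
        also have "nat (i + int l + h) = nat (i + h) + l" using bi by simp
        finally show "map (\<lambda>j. t (2 * j + c + 1)) [i..k] ! l
            = take (nat (k - i + 1)) (drop (nat (i + h)) D) ! l"
          using l bi bk True by simp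
      qed
      then show ?thesis
        by (metis sublist_drop sublist_order.order.trans sublist_take)
    qed simp
    then show "\<exists>n S. folding n S \<and> sublist (map (\<lambda>j. t (2 * j + c + 1)) [i..k]) S"
      using D(1) by blast
  qed
  moreover have "c \<in> {0, 1}" unfolding c_def by auto
  moreover have "s * sg h \<in> {1, -1}" using D(2) by (auto simp: sg_def)
  ultimately show ?thesis by blast
qed

text \<open>Pigeonhole over the four pairs (c, s): if each failed for some \<open>N\<close>, all
  would fail for the largest of the four, by monotonicity.\<close>

lemma complete_folding_deriv:
  assumes "complete_folding_sequence t"
  obtains c s where "c \<in> {0, 1}" "s \<in> {1, -1}" "\<And>j. t (2 * j + c) = s * sg j"
    "complete_folding_sequence (\<lambda>j. t (2 * j + c + 1))"
proof -
  have "\<exists>c\<in>{0, 1}. \<exists>s\<in>{1, -1}. \<forall>N. folds_up_to t c s N"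
  proof (rule ccontr)
    assume "\<not> ?thesis"
    then obtain f where f: "\<And>c s. c \<in> {0, 1} \<Longrightarrow> s \<in> {1, -1} \<Longrightarrow> \<not> folds_up_to t c s (f c s)"
      by metis
    define M where "M = Max {f 0 1, f 0 (-1), f 1 1, f 1 (-1)}"
    have "f c s \<le> M" if "c \<in> {0, 1}" "s \<in> {1, -1}" for c s
      unfolding M_def using that by auto
    then show False using ex_folds_up_to[OF assms, of M] f folds_up_to_mono by meson
  qed
  then obtain c s where cs: "c \<in> {0, 1}" "s \<in> {1, -1}" "\<And>N. folds_up_to t c s N" by blast
  have "t (2 * j + c) = s * sg j" for j
    using cs(3)[of "nat \<bar>2 * j + c\<bar>"] by (simp add: folds_up_to_def)
  moreover have "complete_folding_sequence (\<lambda>j. t (2 * j + c + 1))"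
    unfolding complete_folding_sequence_def
  proof (intro conjI allI)
    show "t (2 * k + c + 1) \<in> {1, -1}" for k
      using assms by (simp add: complete_folding_sequence_def)
    show "\<exists>n S. folding n S \<and> sublist (map (\<lambda>j. t (2 * j + c + 1)) [i..k]) S" for i k
    proof -
      define N where "N = nat (max \<bar>2 * i + c + 1\<bar> \<bar>2 * k + c + 1\<bar>)"
      have "\<bar>2 * i + c + 1\<bar> \<le> int N" "\<bar>2 * k + c + 1\<bar> \<le> int N" by (auto simp: N_def max_def)
      then show ?thesis using cs(3)[of N] unfolding folds_up_to_def by blast
    qed
  qed
  ultimately show thesis using that cs(1,2) by blast
qed

text \<open>Indexing: the turn \<open>t k\<close> takes place at the vertex \<open>X (k + 1)\<close>.\<close>

definition fold_path :: "(int \<Rightarrow> point) \<Rightarrow> (int \<Rightarrow> point) \<Rightarrow> (int \<Rightarrow> int) \<Rightarrow> bool" where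
  "fold_path X u t \<longleftrightarrow> complete_folding_sequence t \<and> (\<forall>k. u k \<in> dirs) \<and>
     (\<forall>k. X (k + 1) = X k + u k) \<and> (\<forall>k. u (k + 1) = smul (t k) (rot (u k)))"

definition traversed :: "(int \<Rightarrow> point) \<Rightarrow> (int \<Rightarrow> point) \<Rightarrow> halfedge set" where
  "traversed X u = {h. \<exists>k. h = (X k, u k) \<or> h = flip (X k, u k)}"

text \<open>The minus sign occurs because the edge just traversed leaves the vertex in direction
  \<open>- u k\<close>. Only vertices in \<open>D\<close> are constrained: a translated curve is
  known to agree with the covering only there.\<close>

definition follows :: "(point \<Rightarrow> int) \<Rightarrow> point set \<Rightarrow> (int \<Rightarrow> point) \<Rightarrow> (int \<Rightarrow> point) \<Rightarrow> bool" where
  "follows \<epsilon> D X u \<longleftrightarrow> (\<forall>k. X (k + 1) \<in> D \<longrightarrow> u (k + 1) = smul (- \<epsilon> (X (k + 1))) (swp (u k)))"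

lemma constant_if_step: "(\<And>k :: int. f (k + 1) = f k) \<Longrightarrow> f k = f 0"
  by (induction k rule: int_induct[of _ 0]) (simp_all, metis diff_add_cancel)

lemma inj_phi: "phi b w = phi b w' \<Longrightarrow> w = w'"
  by (cases w; cases w') (auto simp: phi_def)

text \<open>Alternation along the curve is turned into a condition on positions. Successive retained
  vertices differ by one horizontal and one vertical step, so the parity of the first coordinate
  alternates as the turns \<open>T\<close> do, and the product of the two signs is a constant
  \<open>s\<close>.\<close>

lemma fold_path_deriv:
  assumes "fold_path X u t"
  obtains b s Y v t' where "b \<in> {0, 1}" "s \<in> {1, -1}" "fold_path Y v t'"
    "up b s ` traversed Y v \<subseteq> traversed X u"
    "\<And>\<epsilon> D. D \<subseteq> range X \<Longrightarrow> follows \<epsilon> D X u \<Longrightarrow>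
       obeys b s D \<epsilon> \<and> phi b -` D \<subseteq> range Y \<and> follows (deriv_field b s \<epsilon>) (phi b -` D) Y v"
proof -
  have ud: "u k \<in> dirs" and X1: "X (k + 1) = X k + u k" and u1: "u (k + 1) = smul (t k) (rot (u k))" for k
    using assms by (simp_all add: fold_path_def)
  obtain c s0 where c: "c \<in> {0, 1}" "s0 \<in> {1, -1}" "\<And>j. t (2 * j + c) = s0 * sg j"
    "complete_folding_sequence (\<lambda>j. t (2 * j + c + 1))"
    using complete_folding_deriv assms unfolding fold_path_def by metis
  define T where "T j = t (2 * j + c)" for j
  have T: "T j = 1 \<or> T j = -1" for j
    using c(2) sg_values[of j] unfolding T_def c(3) by auto
  have T1: "T (j + 1) = - T j" for j
    unfolding T_def c(3) by (simp add: sg_def)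
  define x where "x j = X (2 * j + c)" for j
  define d where "d j = u (2 * j + c)" for j
  have dd: "d j \<in> dirs" for j by (simp add: d_def ud)
  have u_odd: "u (2 * j + c + 1) = smul (T j) (rot (d j))" for j
    unfolding T_def d_def by (rule u1)
  have X_odd: "X (2 * j + c + 1) = x j + d j" for j
    unfolding x_def d_def by (rule X1)
  have x1: "x (j + 1) = x j + d j + smul (T j) (rot (d j))" for j
    using X1[of "2 * j + c + 1"] X_odd[of j] u_odd[of j] by (simp add: x_def algebra_simps)
  have d1: "d (j + 1) = smul (t (2 * j + c + 1)) (rot (smul (T j) (rot (d j))))" for j
    using u1[of "2 * j + c + 1"] u_odd[of j] by (simp add: d_def algebra_simps)
  have sgx: "sg (fst (x (j + 1))) = - sg (fst (x j))" for j
    unfolding x1 using dd[of j] T[of j]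
    by (elim dirs_cases disjE) (simp_all add: smul_def rot_def sg_def)
  define s where "s = T 0 * sg (fst (x 0))"
  have sconst: "T j * sg (fst (x j)) = s" for j
    unfolding s_def by (rule constant_if_step[of "\<lambda>j. T j * sg (fst (x j))"]) (simp add: T1 sgx)
  have s: "s \<in> {1, -1}" using T[of 0] sg_values[of "fst (x 0)"] by (auto simp: s_def)
  have Ts: "s * sg (fst (x j)) = T j" for j
    unfolding sconst[of j, symmetric] by (simp add: sg_def)
  define b where "b = (fst (x 0) + snd (x 0)) mod 2"
  have b: "b \<in> {0, 1}" unfolding b_def by auto
  have par: "even (fst (X k) + snd (X k) + b) \<longleftrightarrow> even (k + c)" for k
  proof -
    define f where "f k \<longleftrightarrow> even (fst (X k) + snd (X k) + b + k + c)" for k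
    have "f (k + 1) = f k" for k
      using ud[of k] by (elim dirs_cases) (simp_all add: f_def X1, presburger+)
    then have f0: "f k = f 0" for k by (rule constant_if_step)
    have "f k = f c" using f0[of k] f0[of c] by simp
    moreover have "f c" unfolding f_def b_def x_def by simp presburger
    ultimately show ?thesis unfolding f_def by presburger
  qed
  have parx: "even (fst (x j) + snd (x j) + b)" for j
    using par[of "2 * j + c"] by (simp add: x_def)
  define Y where "Y j = psi b (x j)" for j
  \<comment> \<open>The displacement \<open>d j + smul (T j) (rot (d j))\<close> must be (1 + i)
    \<open>v j\<close>; for T = -1 this uses (1 - i) d = (1 + i) (- i d).\<close>
  define v where "v j = (if T j = 1 then d j else - rot (d j))" for j
  have phiY: "phi b (Y j) = x j" for j
    unfolding Y_def by (rule phi_psi[OF parx])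
  have vd: "v j \<in> dirs" for j by (simp add: v_def dd)
  have Y1: "Y (j + 1) = Y j + v j" for j
  proof (rule inj_phi)
    have "phi b (Y j + v j) = phi b (Y j) + (fst (v j) - snd (v j), fst (v j) + snd (v j))"
      by (simp add: phi_def)
    then show "phi b (Y (j + 1)) = phi b (Y j + v j)"
      unfolding phiY x1 using dd[of j] T[of j]
      by (elim dirs_cases disjE) (simp_all add: v_def smul_def rot_def)
  qed
  have v1: "v (j + 1) = smul (t (2 * j + c + 1)) (rot (v j))" for j
    unfolding v_def d1 T1 using dd[of j] T[of j]
    by (elim dirs_cases disjE) (simp_all add: smul_def rot_def)
  have path: "fold_path Y v (\<lambda>j. t (2 * j + c + 1))"
    unfolding fold_path_def using c(4) vd Y1 v1 by blast
  have up_fwd: "up b s (Y j, v j) = (x j, d j)" for j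
    using T[of j] by (auto simp: up_def phiY Ts v_def rot_def prod_eq_iff)
  have up_bwd: "up b s (flip (Y j, v j)) = flip (X (2 * j + c + 1), u (2 * j + c + 1))" for j
  proof -
    have "up b s (flip (Y j, v j)) = up b s (Y (j + 1), - v j)" by (simp add: flip_def Y1)
    also have "\<dots> = (x (j + 1), if T j = -1 then - v j else - rot (v j))"
      using T[of j] by (auto simp: up_def phiY Ts T1 rot_def)
    also have "\<dots> = flip (X (2 * j + c + 1), u (2 * j + c + 1))"
      using T[of j] unfolding flip_def X_odd u_odd x1
      by (auto simp: v_def smul_def rot_def prod_eq_iff)
    finally show ?thesis .
  qed
  have trav: "up b s ` traversed Y v \<subseteq> traversed X u"
  proof (rule image_subsetI)
    fix h assume "h \<in> traversed Y v"
    then obtain j where "h = (Y j, v j) \<or> h = flip (Y j, v j)" by (auto simp: traversed_def)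
    then show "up b s h \<in> traversed X u"
      using up_fwd[of j] up_bwd[of j] unfolding traversed_def x_def d_def by blast
  qed
  have "obeys b s D \<epsilon> \<and> phi b -` D \<subseteq> range Y \<and> follows (deriv_field b s \<epsilon>) (phi b -` D) Y v"
    if D: "D \<subseteq> range X" and fo: "follows \<epsilon> D X u" for \<epsilon> D
  proof (intro conjI)
    show "obeys b s D \<epsilon>"
      unfolding obeys_def
    proof (intro ballI impI)
      fix A assume A: "A \<in> D" "odd (fst A + snd A + b)"
      then obtain k where k: "A = X k" using D by blast
      then have "odd (k + c)" using par A(2) by blast
      then have "k = 2 * ((k - c - 1) div 2) + c + 1" by presburger
      then obtain j where j: "k = 2 * j + c + 1" by blast
      have "u (2 * j + c + 1) = smul (- \<epsilon> A) (swp (d j))"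
        using fo A(1) unfolding follows_def k j d_def by blast
      then have "smul (T j) (rot (d j)) = smul (- \<epsilon> A) (swp (d j))" by (simp add: u_odd)
      moreover have "A = x j + d j" using k j X_odd by simp
      \<comment> \<open>For horizontal \<open>d j\<close>, \<open>rot\<close> agrees with
        \<open>swp\<close> and the step to \<open>A\<close> changes the parity of the first
        coordinate; for vertical \<open>d j\<close>, \<open>rot\<close> is \<open>- swp\<close> and
        the parity stays. The signs cancel to the same formula.\<close>
      ultimately show "\<epsilon> A = s * sg (fst A)"
        using dd[of j] Ts[of j]
        by (elim dirs_cases) (auto simp: smul_def rot_def swp_def sg_def split: if_splits)
    qed
    show "phi b -` D \<subseteq> range Y"
    proof
      fix w assume "w \<in> phi b -` D"
      then obtain k where k: "phi b w = X k" using D by blast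
      have "even (fst (phi b w) + snd (phi b w) + b)" by (simp add: phi_def)
      then have "even (k + c)" using par k by simp
      then have "even (k - c)" by simp
      then have "k = 2 * ((k - c) div 2) + c" by presburger
      then obtain j where "k = 2 * j + c" by blast
      then have "phi b w = phi b (Y j)" using k by (simp add: phiY x_def)
      then show "w \<in> range Y" using inj_phi by blast
    qed
    show "follows (deriv_field b s \<epsilon>) (phi b -` D) Y v"
      unfolding follows_def
    proof (intro allI impI)
      fix j assume "Y (j + 1) \<in> phi b -` D"
      then have xD: "x (j + 1) \<in> D" by (simp add: phiY)
      have x2: "x (j + 1) = X (2 * j + c + 1 + 1)" by (simp add: x_def algebra_simps)
      have "u (2 * j + c + 1 + 1) = smul (- \<epsilon> (x (j + 1))) (swp (u (2 * j + c + 1)))"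
        using fo xD unfolding follows_def x2 by blast
      moreover have "d (j + 1) = u (2 * j + c + 1 + 1)" by (simp add: d_def algebra_simps)
      ultimately have "d (j + 1) = smul (- \<epsilon> (x (j + 1))) (swp (smul (T j) (rot (d j))))"
        by (simp only: u_odd)
      moreover have "deriv_field b s \<epsilon> (Y (j + 1)) = - T j * \<epsilon> (x (j + 1))"
        by (simp add: deriv_field_def phiY Ts T1)
      ultimately show "v (j + 1) = smul (- deriv_field b s \<epsilon> (Y (j + 1))) (swp (v j))"
        using T[of j] by (auto simp: v_def T1 smul_def rot_def swp_def)
    qed
  qed
  then show thesis by (rule that[OF b s path trav])
qed

lemma layered_fold_path:
  "fold_path X u t \<Longrightarrow> D \<subseteq> range X \<Longrightarrow> follows \<epsilon> D X u \<Longrightarrow> layered n D \<epsilon>"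
proof (induction n arbitrary: X u t D \<epsilon>)
  case (Suc n)
  from Suc.prems(1) show ?case
  proof (rule fold_path_deriv)
    fix b s Y v t'
    assume bs: "b \<in> {0, 1}" "s \<in> {1, -1}" and Y: "fold_path Y v t'"
      and deriv: "\<And>\<epsilon> D. D \<subseteq> range X \<Longrightarrow> follows \<epsilon> D X u \<Longrightarrow>
        obeys b s D \<epsilon> \<and> phi b -` D \<subseteq> range Y \<and> follows (deriv_field b s \<epsilon>) (phi b -` D) Y v"
    have "obeys b s D \<epsilon>" "layered n (phi b -` D) (deriv_field b s \<epsilon>)"
      using deriv[OF Suc.prems(2,3)] Suc.IH[OF Y] by blast+
    then show ?case unfolding layered.simps using bs by blast
  qed
qed simp

section \<open>Discs traversed by a single folding path\<close>

fun words :: "nat \<Rightarrow> int list list" where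
  "words 0 = [[]]"
| "words (Suc n) = map (interl 1) (words n) @ map (interl (- 1)) (words n)"

text \<open>A word at index \<open>j\<close> of the derived sequence lifts to one at
  \<open>2 * j + c\<close> whose first inserted sign is \<open>s * sg j\<close>. For n = 6 this
  leaves 64 words of length 63.\<close>

lemma complete_folding_word:
  "complete_folding_sequence t \<Longrightarrow>
     \<exists>j. \<exists>w\<in>set (words n). \<forall>i<length w. t (j + int i) = w ! i"
proof (induction n arbitrary: t)
  case 0
  then show ?case by simp
next
  case (Suc n)
  obtain c s where cs: "s \<in> {1, -1}" "\<And>j. t (2 * j + c) = s * sg j"
    "complete_folding_sequence (\<lambda>j. t (2 * j + c + 1))"
    using complete_folding_deriv[OF Suc.prems] by metis
  obtain j w where w: "w \<in> set (words n)" "\<And>i. i < length w \<Longrightarrow> t (2 * (j + int i) + c + 1) = w ! i"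
    using Suc.IH[OF cs(3)] by auto
  define s' where "s' = s * sg j"
  have "s' = 1 \<or> s' = -1" using cs(1) sg_values[of j] by (auto simp: s'_def)
  then have "interl s' w \<in> set (words (Suc n))" using w(1) by auto
  moreover have "t (2 * j + c + int i) = interl s' w ! i" if "i < length (interl s' w)" for i
  proof (cases "even i")
    case True
    then obtain m where m: "i = 2 * m" by blast
    then have ml: "m \<le> length w" using that by simp
    have "(- 1) ^ m = sg (int m)" using neg_one_power_nat[of "int m"] by simp
    then have "interl s' w ! i = s * sg (j + int m)"
      using nth_interl_even[OF ml, of s'] m by (simp add: s'_def sg_add)
    moreover have "2 * j + c + int i = 2 * (j + int m) + c" using m by simp
    ultimately show ?thesis using cs(2)[of "j + int m"] by (simp only:)
  next
    case False
    then obtain m where m: "i = 2 * m + 1" by (metis oddE)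
    then have ml: "m < length w" using that by simp
    have "2 * j + c + int i = 2 * (j + int m) + c + 1" using m by simp
    then show ?thesis using w(2)[OF ml] nth_interl_odd[OF ml, of s'] m by (simp only:)
  qed
  ultimately show ?case by blast
qed

fun trajectory :: "halfedge \<Rightarrow> int list \<Rightarrow> halfedge list" where
  "trajectory h [] = [h]"
| "trajectory h (t # w) = h # trajectory (fst h + snd h, smul t (rot (snd h))) w"

lemma trajectory_traversed:
  assumes "fold_path X u t"
  shows "(\<forall>i<length w. t (j + int i) = w ! i) \<Longrightarrow> set (trajectory (X j, u j) w) \<subseteq> traversed X u"
proof (induction w arbitrary: j)
  case Nil
  then show ?case by (auto simp: traversed_def)
next
  case (Cons a w)
  have a: "t j = a" using Cons.prems[rule_format, of 0] by simp
  have "\<forall>i<length w. t (j + 1 + int i) = w ! i"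
  proof (intro allI impI)
    fix i assume "i < length w"
    then have "t (j + int (Suc i)) = (a # w) ! Suc i" using Cons.prems by auto
    moreover have "j + int (Suc i) = j + 1 + int i" by simp
    ultimately show "t (j + 1 + int i) = w ! i" by (simp only: nth_Cons_Suc)
  qed
  from Cons.IH[OF this] have "set (trajectory (X (j + 1), u (j + 1)) w) \<subseteq> traversed X u" .
  moreover have "X (j + 1) = X j + u j" "u (j + 1) = smul a (rot (u j))"
    using assms a by (auto simp: fold_path_def)
  ultimately show ?case by (auto simp: traversed_def)
qed

text \<open>The product of Gaussian integers. Turns determine a path up to the rigid motions
  \<open>move g\<close> with unit \<open>snd g\<close>, so a search from one standard start
  suffices.\<close>

definition cmul :: "point \<Rightarrow> point \<Rightarrow> point" where
  "cmul e p = smul (fst p) e + smul (snd p) (rot e)"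

definition move :: "halfedge \<Rightarrow> halfedge \<Rightarrow> halfedge" where
  "move g h = (fst g + cmul (snd g) (fst h), cmul (snd g) (snd h))"

lemma cmul_simps: "cmul e (p + q) = cmul e p + cmul e q" "cmul e (- p) = - cmul e p"
  "cmul e (p - q) = cmul e p - cmul e q"
  "cmul e (rot p) = rot (cmul e p)" "cmul e (smul t p) = smul t (cmul e p)"
  by (auto simp: cmul_def smul_def rot_def algebra_simps prod_eq_iff)

lemma move_flip: "move g (flip h) = flip (move g h)"
  by (simp add: move_def flip_def cmul_simps add.assoc)

lemma move_start: "move g ((0, 0), (1, 0)) = g"
  by (cases g) (simp add: move_def cmul_def smul_def prod_eq_iff)

lemma trajectory_move: "trajectory (move g h) w = map (move g) (trajectory h w)"
proof (induction w arbitrary: h)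
  case (Cons a w)
  have "move g (fst h + snd h, smul a (rot (snd h))) =
      (fst (move g h) + snd (move g h), smul a (rot (snd (move g h))))"
    by (simp add: move_def cmul_simps add.assoc)
  then show ?case using Cons.IH[of "(fst h + snd h, smul a (rot (snd h)))"] by simp
qed simp

text \<open>The nine edges whose midpoints are at distance less than \<open>sqrt 2\<close> from the midpoint of \<open>h\<close>.
  This exceeds the critical radius \<open>1 / (2 * (sqrt 2 - 1))\<close>, so refining a curve that traverses
  a patch makes it traverse ever larger discs.\<close>

definition patch :: "halfedge \<Rightarrow> halfedge list" where
  "patch h = (let P = fst h; d = snd h; Q = P + d; n = rot d in
     [(P, d), (P, n), (P, - n), (P, - d), (Q, n), (Q, - n), (Q, d), (P + n, d), (P - n, d)])"

lemma patch_move: "patch (move g h) = map (move g) (patch h)"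
  by (simp add: patch_def Let_def move_def cmul_simps add.assoc add_diff_eq)

text \<open>The listed indices were found by search: each of the 64 words of \<open>words 6\<close> has a
  patch centred at one of them.\<close>

definition has_patch :: "int list \<Rightarrow> bool" where
  "has_patch w = (let T = trajectory ((0, 0), (1, 0)) w in
     list_ex (\<lambda>i. list_all (\<lambda>g. g \<in> set T \<or> flip g \<in> set T) (patch (T ! i)))
       [27, 19, 37, 42, 10, 28, 26, 34])"

lemma has_patch_words6: "list_all has_patch (words 6)"
  by code_simp

lemma traversed_flip: "flip h \<in> traversed X u \<longleftrightarrow> h \<in> traversed X u"
proof -
  have "flip g \<in> traversed X u" if "g \<in> traversed X u" for g
    using that unfolding traversed_def by auto
  from this[of h] this[of "flip h"] show ?thesis by auto
qed

lemma traversed_dirs: "fold_path X u t \<Longrightarrow> h \<in> traversed X u \<Longrightarrow> snd h \<in> dirs"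
  by (auto simp: traversed_def fold_path_def)

lemma patch_traversed:
  assumes X: "fold_path X u t"
  obtains h where "snd h \<in> dirs" "set (patch h) \<subseteq> traversed X u"
proof -
  obtain j w where w: "w \<in> set (words 6)" "\<forall>i<length w. t (j + int i) = w ! i"
    using complete_folding_word X unfolding fold_path_def by blast
  define T where "T = trajectory ((0, 0), (1, 0)) w"
  define g where "g = (X j, u j)"
  have "has_patch w" using has_patch_words6 w(1) by (simp add: list_all_iff)
  then obtain i where i: "\<And>k. k \<in> set (patch (T ! i)) \<Longrightarrow> k \<in> set T \<or> flip k \<in> set T"
    unfolding has_patch_def Let_def T_def list_ex_iff list_all_iff by blast
  have "trajectory g w = map (move g) T"
    using trajectory_move[of g "((0, 0), (1, 0))" w] by (simp add: move_start T_def)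
  then have T: "move g ` set T \<subseteq> traversed X u"
    using trajectory_traversed[OF X w(2)] by (simp add: g_def)
  have sub: "set (patch (move g (T ! i))) \<subseteq> traversed X u"
  proof
    fix h assume "h \<in> set (patch (move g (T ! i)))"
    then obtain k where k: "k \<in> set (patch (T ! i))" "h = move g k" by (auto simp: patch_move)
    from i[OF k(1)] show "h \<in> traversed X u"
      using T k(2) move_flip[of g k] traversed_flip by (metis imageI subsetD)
  qed
  have "move g (T ! i) \<in> set (patch (move g (T ! i)))" by (simp add: patch_def Let_def)
  then show thesis using that sub traversed_dirs[OF X] by blast
qed

text \<open>The coordinates are differences of doubled midpoints, so the bound 7 means midpoint
  distance below sqrt 2.\<close>

lemma patch_disc:
  "list_all (\<lambda>d. list_all (\<lambda>e. list_all (\<lambda>x. list_all (\<lambda>y.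
     (2 * x + fst e - fst d)\<^sup>2 + (2 * y + snd e - snd d)\<^sup>2 \<le> 7 \<longrightarrow>
       ((x, y), e) \<in> set (patch ((0, 0), d)) \<or> flip ((x, y), e) \<in> set (patch ((0, 0), d)))
     [-2..2]) [-2..2]) [(1, 0), (0, 1), (-1, 0), (0, -1)]) [(1, 0), (0, 1), (-1, 0), (0, -1)]"
  by code_simp

lemma near_patch:
  assumes g: "snd g \<in> dirs" and h: "h \<in> near (mid g) (7 / 5)"
  shows "h \<in> set (patch g) \<or> flip h \<in> set (patch g)"
proof -
  obtain P d where gd: "g = (P, d)" by (cases g)
  obtain Q e where he: "h = (Q, e)" by (cases h)
  obtain x y where xy: "Q - P = (x, y)" by (cases "Q - P")
  define m n where "m = 2 * x + fst e - fst d" and "n = 2 * y + snd e - snd d"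
  have d: "d \<in> dirs" and e: "e \<in> dirs" and hm: "cmod (mid h - mid g) \<le> 7 / 5"
    using g h by (auto simp: near_def gd he)
  have Q: "Q = P + (x, y)" using xy by (metis add_diff_cancel_left' diff_add_cancel add.commute)
  have "2 * (mid h - mid g) = Complex (of_int m) (of_int n)"
    by (simp add: gd he Q mid_def cx_def m_def n_def complex_eq_iff field_simps)
  then have "cmod (Complex (of_int m) (of_int n)) = 2 * cmod (mid h - mid g)"
    by (metis norm_mult norm_numeral)
  then have "sqrt (real_of_int (m\<^sup>2 + n\<^sup>2)) \<le> 14 / 5"
    using hm by (simp add: complex_norm)
  then have "real_of_int (m\<^sup>2 + n\<^sup>2) \<le> (14 / 5)\<^sup>2" by (rule sqrt_le_D)
  then have "real_of_int (m\<^sup>2 + n\<^sup>2) < 8" by (simp add: power2_eq_square)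
  then have le: "m\<^sup>2 + n\<^sup>2 \<le> 7" by linarith
  have bnd: "\<bar>k\<bar> \<le> 2" if "k\<^sup>2 \<le> 7" for k :: int
  proof (rule ccontr)
    assume "\<not> ?thesis"
    then have "3\<^sup>2 \<le> k\<^sup>2" by (subst abs_le_square_iff[symmetric]) simp
    then show False using that by simp
  qed
  have "m\<^sup>2 \<le> 7" "n\<^sup>2 \<le> 7" using le zero_le_power2[of m] zero_le_power2[of n] by linarith+
  then have "\<bar>m\<bar> \<le> 2" "\<bar>n\<bar> \<le> 2" by (auto intro: bnd)
  then have "x \<in> set [-2..2]" "y \<in> set [-2..2]"
    using d e unfolding set_upto m_def n_def by (auto elim!: dirs_cases)
  moreover have "d \<in> set [(1, 0), (0, 1), (-1, 0), (0, -1)]" "e \<in> set [(1, 0), (0, 1), (-1, 0), (0, -1)]"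
    using d e by (auto simp: dirs_def)
  ultimately have "((x, y), e) \<in> set (patch ((0, 0), d)) \<or> flip ((x, y), e) \<in> set (patch ((0, 0), d))"
    using patch_disc le unfolding list_all_iff m_def n_def by blast
  then have *: "move (P, (1, 0)) ((x, y), e) \<in> set (patch (move (P, (1, 0)) ((0, 0), d))) \<or>
      flip (move (P, (1, 0)) ((x, y), e)) \<in> set (patch (move (P, (1, 0)) ((0, 0), d)))"
    unfolding patch_move by (auto simp: move_flip[symmetric])
  have "move (P, (1, 0)) ((0, 0), d) = g" "move (P, (1, 0)) ((x, y), e) = h"
    by (simp_all add: move_def cmul_def smul_def rot_def prod_eq_iff gd he Q)
  with * show ?thesis by (simp only:)
qed

text \<open>\<open>down_near\<close> read backwards: edges of the larger disc coarsen into the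
  smaller one, so each refinement multiplies the excess of the radius over 5/4 by sqrt 2. The
  initial excess is 7/5 - 5/4 = 3/20.\<close>

lemma disc_traversed:
  "fold_path X u t \<Longrightarrow> \<exists>z. near z (5 / 4 + 3 / 20 * sqrt 2 ^ n) \<subseteq> traversed X u"
proof (induction n arbitrary: X u t)
  case 0
  obtain g where g: "snd g \<in> dirs" "set (patch g) \<subseteq> traversed X u"
    using patch_traversed[OF 0] .
  have "near (mid g) (7 / 5) \<subseteq> traversed X u"
    using near_patch[OF g(1)] g(2) traversed_flip by blast
  then show ?case by (intro exI[of _ "mid g"]) simp
next
  case (Suc n)
  from Suc.prems show ?case
  proof (rule fold_path_deriv)
    fix b s Y v t'
    assume Y: "fold_path Y v t'" and up: "up b s ` traversed Y v \<subseteq> traversed X u"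
    define r where "r = 5 / 4 + 3 / 20 * sqrt 2 ^ n"
    obtain z where z: "near z r \<subseteq> traversed Y v" using Suc.IH[OF Y] unfolding r_def by blast
    define z' where "z' = of_int b + (1 + \<i>) * z"
    have "1 + \<i> \<noteq> 0" by (simp add: complex_eq_iff)
    then have zz: "(z' - of_int b) / (1 + \<i>) = z" by (simp add: z'_def)
    have "(7 / 5 :: real) \<le> sqrt 2" by (rule real_le_rsqrt) (simp add: power2_eq_square)
    then have r: "(5 / 4 + 3 / 20 * sqrt 2 ^ Suc n + 1 / 2) / sqrt 2 \<le> r"
      by (simp add: r_def field_simps)
    have "near z' (5 / 4 + 3 / 20 * sqrt 2 ^ Suc n) \<subseteq> traversed X u"
    proof
      fix h assume h: "h \<in> near z' (5 / 4 + 3 / 20 * sqrt 2 ^ Suc n)"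
      have "down b s h \<in> near z r"
        using down_near[OF h, of b s] r unfolding zz near_def by fastforce
      then have "up b s (down b s h) \<in> traversed X u" using z up by blast
      moreover have "snd h \<in> dirs" using h by (simp add: near_def)
      ultimately show "h \<in> traversed X u" using up_down[of h b s] traversed_flip by metis
    qed
    then show ?case by blast
  qed
qed

section \<open>The pairing field of a covering\<close>

lemma pt_eq_iff [simp]: "pt X = pt Y \<longleftrightarrow> X = Y"
  by (auto simp: pt_def prod_eq_iff)

lemma support_eq_iff:
  "support s = support s' \<longleftrightarrow> s = s' \<or> s = (snd s', fst s')"
  by (cases s; cases s') (auto simp: support_def doubleton_eq_iff)

lemma unit_vector_dirs: "x\<^sup>2 + y\<^sup>2 = 1 \<longleftrightarrow> (x, y) \<in> dirs" for x y :: int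
proof
  assume h: "x\<^sup>2 + y\<^sup>2 = 1"
  then have "x\<^sup>2 \<le> 1" "y\<^sup>2 \<le> 1" by (smt (verit) zero_le_power2)+
  then have "\<bar>x\<bar> \<le> 1" "\<bar>y\<bar> \<le> 1" by (simp_all add: abs_square_le_1)
  then have "x \<in> {-1, 0, 1}" "y \<in> {-1, 0, 1}" by auto
  with h show "(x, y) \<in> dirs" by (auto simp: dirs_def)
qed (auto simp: dirs_def)

lemma is_segment_iff: "is_segment s \<longleftrightarrow> direction s \<in> dirs"
proof -
  obtain a b c d where s: "s = ((a, b), (c, d))" by (metis prod.exhaust)
  have "is_segment s \<longleftrightarrow> sqrt (real_of_int ((c - a)\<^sup>2 + (d - b)\<^sup>2)) = 1"
    by (simp add: is_segment_def s pt_def dist_Pair_Pair dist_real_def power2_commute)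
  also have "\<dots> \<longleftrightarrow> (c - a)\<^sup>2 + (d - b)\<^sup>2 = 1"
    by (metis of_int_eq_1_iff real_sqrt_eq_1_iff)
  finally show ?thesis by (simp add: unit_vector_dirs direction_def s)
qed

lemma orthogonal_dirs:
  assumes "d \<in> dirs" "d' \<in> dirs" "orthogonal (pt d) (pt d')"
  shows "d' = swp d \<or> d' = - swp d"
  using assms by (auto simp: dirs_def orthogonal_def pt_def swp_def)

definition curve_in :: "(int \<Rightarrow> segment) set set \<Rightarrow> (int \<Rightarrow> segment) \<Rightarrow> bool" where
  "curve_in \<C> c \<longleftrightarrow> complete_folding_curve c \<and> index_shift `` {c} \<in> \<C>"

lemma shift_class: "index_shift `` {c} = {d. \<exists>k. \<forall>i. d i = c (i + k)}"
  by (auto simp: index_shift_def)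

lemma segments_of_class: "segments_of (index_shift `` {c}) = range c"
proof -
  have "c i \<in> segments_of (index_shift `` {c})" for i
    unfolding segments_of_def shift_class by (auto intro!: exI[of _ c] exI[of _ 0])
  then show ?thesis unfolding segments_of_def shift_class by auto
qed

lemma covering_class:
  assumes "covering \<C>" "K \<in> \<C>"
  obtains c where "curve_in \<C> c" "K = index_shift `` {c}"
  using assms unfolding covering_def complete_folding_curves_def curve_in_def
  by (metis mem_Collect_eq quotientE subsetD)

lemma decorated_segments_eq:
  assumes "covering \<C>"
  shows "decorated_segments \<C> = {(support (c (i - 1)), c i, support (c (i + 1))) | c i. curve_in \<C> c}"
    (is "?L = ?R")
proof
  show "?L \<subseteq> ?R"
  proof
    fix x assume "x \<in> ?L"
    then obtain K d i where x: "x = (support (d (i - 1)), d i, support (d (i + 1)))" "K \<in> \<C>" "d \<in> K"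
      by (auto simp: decorated_segments_def)
    obtain c where c: "curve_in \<C> c" "K = index_shift `` {c}" using covering_class[OF assms x(2)] .
    then obtain k where "\<And>i. d i = c (i + k)" using x(3) unfolding shift_class by auto
    then have "x = (support (c (i + k - 1)), c (i + k), support (c (i + k + 1)))"
      by (simp add: x(1) algebra_simps)
    then show "x \<in> ?R" using c(1) by blast
  qed
  show "?R \<subseteq> ?L"
  proof
    fix x assume "x \<in> ?R"
    then obtain c i where c: "x = (support (c (i - 1)), c i, support (c (i + 1)))" "curve_in \<C> c"
      by blast
    moreover have "c \<in> index_shift `` {c}" unfolding shift_class by (auto intro: exI[of _ 0])
    ultimately show "x \<in> ?L" unfolding decorated_segments_def curve_in_def by blast
  qed
qed

lemma curve_inD:
  assumes "curve_in \<C> c"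
  shows "direction (c i) \<in> dirs" "snd (c i) = fst (c (i + 1))"
    "direction (c (i + 1)) = swp (direction (c i)) \<or> direction (c (i + 1)) = - swp (direction (c i))"
    "support (c i) = support (c j) \<Longrightarrow> i = j"
    "complete_folding_sequence (associated_sequence c)"
proof -
  have c: "complete_curve c" "complete_folding_sequence (associated_sequence c)"
    using assms unfolding curve_in_def complete_folding_curve_def by blast+
  then show "complete_folding_sequence (associated_sequence c)" by blast
  show d: "direction (c i) \<in> dirs" for i
    using c(1) unfolding complete_curve_def is_segment_iff by blast
  show "snd (c i) = fst (c (i + 1))" using c(1) unfolding complete_curve_def by blast
  have "orthogonal (pt (direction (c i))) (pt (direction (c (i + 1))))"
    using c(1) unfolding complete_curve_def by blast
  with d[of i] d[of "i + 1"]
  show "direction (c (i + 1)) = swp (direction (c i)) \<or> direction (c (i + 1)) = - swp (direction (c i))"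
    by (rule orthogonal_dirs)
  show "support (c i) = support (c j) \<Longrightarrow> i = j"
    using c(1) unfolding complete_curve_def by blast
qed

lemma segment_eq: "s = (fst s, fst s + direction s)" "s = (snd s - direction s, snd s)"
  by (simp_all add: direction_def prod_eq_iff)

text \<open>Uniqueness of the covering segment fixes class and orientation; distinctness of supports
  within a curve then fixes the index shift.\<close>

lemma covering_unique:
  assumes C: "covering \<C>" and c: "curve_in \<C> c" "curve_in \<C> c'"
    and eq: "support (c i) = support (c' i')"
  shows "c' (i' + j) = c (i + j)" "index_shift `` {c} = index_shift `` {c'}"
proof -
  let ?e = "support (c i)"
  have "?e \<in> unit_edges"
    using curve_inD(1)[OF c(1)] by (auto simp: unit_edges_def is_segment_iff)
  then have ex: "\<exists>!(K, s). K \<in> \<C> \<and> s \<in> segments_of K \<and> support s = ?e"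
    using C by (simp add: covering_def)
  have 1: "case (index_shift `` {c}, c i) of (K, s) \<Rightarrow> K \<in> \<C> \<and> s \<in> segments_of K \<and> support s = ?e"
    using c(1) by (simp add: segments_of_class curve_in_def)
  have 2: "case (index_shift `` {c'}, c' i') of (K, s) \<Rightarrow> K \<in> \<C> \<and> s \<in> segments_of K \<and> support s = ?e"
    using c(2) eq by (simp add: segments_of_class curve_in_def)
  have both: "(index_shift `` {c}, c i) = (index_shift `` {c'}, c' i')"
    by (rule ex1E[OF ex]) (use 1 2 in blast)
  then show cl: "index_shift `` {c} = index_shift `` {c'}" by simp
  have "c' \<in> index_shift `` {c'}" unfolding shift_class by (auto intro: exI[of _ 0])
  then have "c' \<in> index_shift `` {c}" using cl by simp
  then obtain k where k: "\<And>i. c' i = c (i + k)" unfolding shift_class by auto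
  then have "support (c (i' + k)) = support (c i)" using both by simp
  then have "i' + k = i" by (rule curve_inD(4)[OF c(1)])
  moreover have "c' (i' + j) = c (i' + k + j)" using k[of "i' + j"] by (simp add: algebra_simps)
  ultimately show "c' (i' + j) = c (i + j)" by simp
qed

lemma covering_exists:
  assumes C: "covering \<C>" and d: "d \<in> dirs"
  obtains c i where "curve_in \<C> c" "c i = (P, P + d) \<or> c i = (P + d, P)"
proof -
  have "support (P, P + d) \<in> unit_edges"
    using d by (auto simp: unit_edges_def is_segment_iff direction_def)
  then have "\<exists>!(K, s). K \<in> \<C> \<and> s \<in> segments_of K \<and> support s = support (P, P + d)"
    using C by (simp add: covering_def)
  then obtain K s where Ks: "K \<in> \<C>" "s \<in> segments_of K" "support s = support (P, P + d)"
    by auto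
  obtain c where c: "curve_in \<C> c" "K = index_shift `` {c}" using covering_class[OF C Ks(1)] .
  then obtain i where "s = c i" using Ks(2) segments_of_class by auto
  then show thesis using that[OF c(1)] Ks(3) by (auto simp: support_eq_iff)
qed

definition pass :: "(int \<Rightarrow> segment) set set \<Rightarrow> point \<Rightarrow> point \<Rightarrow> point \<Rightarrow> bool" where
  "pass \<C> P d d' \<longleftrightarrow> (\<exists>c i. curve_in \<C> c \<and>
     (c i = (P + d, P) \<and> c (i + 1) = (P, P + d') \<or> c i = (P + d', P) \<and> c (i + 1) = (P, P + d)))"

lemma pass_sym: "pass \<C> P d d' \<Longrightarrow> pass \<C> P d' d"
  unfolding pass_def by blast

lemma curve_pass:
  assumes "curve_in \<C> c"
  shows "pass \<C> (fst (c (i + 1))) (- direction (c i)) (direction (c (i + 1)))"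
proof -
  have "c i = (fst (c (i + 1)) + - direction (c i), fst (c (i + 1)))"
    using segment_eq(2)[of "c i"] curve_inD(2)[OF assms, of i] by simp
  then show ?thesis unfolding pass_def using assms segment_eq(1)[of "c (i + 1)"] by blast
qed

lemma pass_exists:
  assumes "covering \<C>" "d \<in> dirs"
  obtains d' where "pass \<C> P d d'"
proof -
  obtain c i where c: "curve_in \<C> c" "c i = (P, P + d) \<or> c i = (P + d, P)"
    using covering_exists[OF assms] .
  from c(2) show thesis
  proof
    assume ci: "c i = (P, P + d)"
    then have "pass \<C> P (- direction (c (i - 1))) d"
      using curve_pass[OF c(1), of "i - 1"] by (simp add: direction_def)
    then show thesis using that pass_sym by blast
  next
    assume ci: "c i = (P + d, P)"
    then have "fst (c (i + 1)) = P" using curve_inD(2)[OF c(1), of i] by simp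
    then have "pass \<C> P d (direction (c (i + 1)))"
      using curve_pass[OF c(1), of i] ci by (simp add: direction_def)
    then show thesis by (rule that)
  qed
qed

lemma pass_dirs:
  assumes "pass \<C> P d d'"
  shows "d \<in> dirs" "d' \<in> dirs" "d' = swp d \<or> d' = - swp d"
proof -
  obtain c i where c: "curve_in \<C> c"
    "c i = (P + d, P) \<and> c (i + 1) = (P, P + d') \<or> c i = (P + d', P) \<and> c (i + 1) = (P, P + d)"
    using assms unfolding pass_def by blast
  have "direction (c i) = - d \<and> direction (c (i + 1)) = d' \<or> direction (c i) = - d' \<and> direction (c (i + 1)) = d"
    using c(2) by (auto simp: direction_def)
  then show "d \<in> dirs" "d' \<in> dirs" "d' = swp d \<or> d' = - swp d"
    using curve_inD(1)[OF c(1), of i] curve_inD(1)[OF c(1), of "i + 1"] curve_inD(3)[OF c(1), of i]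
    by (auto simp: swp_def)
qed

lemma zero_not_dirs: "0 \<notin> dirs"
  by (simp add: dirs_def prod_eq_iff)

text \<open>An edge is covered in one orientation only, so the mixed cases, where it is traversed
  towards \<open>P\<close> in one passage and away from \<open>P\<close> in the other, are
  contradictory.\<close>

lemma pass_unique:
  assumes C: "covering \<C>" and p: "pass \<C> P d d'" "pass \<C> P d d''"
  shows "d' = d''"
proof -
  have d0: "P + d \<noteq> P" using pass_dirs(1)[OF p(1)] zero_not_dirs by auto
  have sup: "support (P, P + d) = support (P + d, P)" by (simp add: support_eq_iff)
  obtain c i where c: "curve_in \<C> c"
    "c i = (P + d, P) \<and> c (i + 1) = (P, P + d') \<or> c i = (P + d', P) \<and> c (i + 1) = (P, P + d)"
    using p(1) unfolding pass_def by blast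
  obtain b j where b: "curve_in \<C> b"
    "b j = (P + d, P) \<and> b (j + 1) = (P, P + d'') \<or> b j = (P + d'', P) \<and> b (j + 1) = (P, P + d)"
    using p(2) unfolding pass_def by blast
  note u = covering_unique(1)[OF C c(1) b(1)]
  consider
    "c i = (P + d, P)" "c (i + 1) = (P, P + d')" "b j = (P + d, P)" "b (j + 1) = (P, P + d'')" |
    "c i = (P + d, P)" "c (i + 1) = (P, P + d')" "b j = (P + d'', P)" "b (j + 1) = (P, P + d)" |
    "c i = (P + d', P)" "c (i + 1) = (P, P + d)" "b j = (P + d, P)" "b (j + 1) = (P, P + d'')" |
    "c i = (P + d', P)" "c (i + 1) = (P, P + d)" "b j = (P + d'', P)" "b (j + 1) = (P, P + d)"
    using b(2) c(2) by blast
  then show ?thesis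
  proof cases
    case 1
    then show ?thesis using u[of i j 1] by simp
  next
    case 2
    then show ?thesis using u[of i "j + 1" 0] sup d0 by simp
  next
    case 3
    then show ?thesis using u[of "i + 1" j 0] sup d0 by simp
  next
    case 4
    then show ?thesis using u[of "i + 1" "j + 1" "- 1"] by simp
  qed
qed

definition pairing :: "(int \<Rightarrow> segment) set set \<Rightarrow> point \<Rightarrow> int" where
  "pairing \<C> P = (if pass \<C> P (1, 0) (0, 1) then 1 else -1)"

text \<open>Partners are perpendicular and unique, so the partner of east forces that of west and
  with it the whole matching.\<close>

lemma pass_pairing:
  assumes C: "covering \<C>" and d: "d \<in> dirs"
  shows "pass \<C> P d (smul (pairing \<C> P) (swp d))"
proof -
  have ex: "pass \<C> P e (swp e) \<or> pass \<C> P e (- swp e)" if "e \<in> dirs" for e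
    using pass_exists[OF C that, of P] pass_dirs(3) by metis
  note uq = pass_unique[OF C]
  have E: "pass \<C> P (1, 0) (0, 1) \<or> pass \<C> P (1, 0) (0, -1)"
    using ex[of "(1, 0)"] by (simp add: dirs_def swp_def)
  have W: "pass \<C> P (-1, 0) (0, -1) \<or> pass \<C> P (-1, 0) (0, 1)"
    using ex[of "(-1, 0)"] by (simp add: dirs_def swp_def)
  show ?thesis
  proof (cases "pass \<C> P (1, 0) (0, 1)")
    case True
    then have "\<not> pass \<C> P (-1, 0) (0, 1)" using uq[of P "(0, 1)" "(1, 0)" "(-1, 0)"] pass_sym by fastforce
    then have "pass \<C> P (-1, 0) (0, -1)" using W by blast
    then show ?thesis
      using True pass_sym[OF True] pass_sym[of \<C> P "(-1, 0)" "(0, -1)"] d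
      by (auto simp: pairing_def dirs_def smul_def swp_def)
  next
    case False
    then have E': "pass \<C> P (1, 0) (0, -1)" using E by blast
    then have "\<not> pass \<C> P (-1, 0) (0, -1)"
      using uq[of P "(0, -1)" "(1, 0)" "(-1, 0)"] pass_sym by fastforce
    then have "pass \<C> P (-1, 0) (0, 1)" using W by blast
    then show ?thesis
      using False E' pass_sym[OF E'] pass_sym[of \<C> P "(-1, 0)" "(0, 1)"] d
      by (auto simp: pairing_def dirs_def smul_def swp_def)
  qed
qed

lemma pass_eq_pairing:
  assumes "covering \<C>" "pass \<C> P d d'"
  shows "d' = smul (pairing \<C> P) (swp d)"
  using pass_unique[OF assms(1,2)] pass_pairing[OF assms(1) pass_dirs(1)[OF assms(2)]] by blast

definition curve_at :: "(int \<Rightarrow> segment) set set \<Rightarrow> halfedge \<Rightarrow> (int \<Rightarrow> segment) set" where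
  "curve_at \<C> h = (SOME K. \<exists>c i. curve_in \<C> c \<and> K = index_shift `` {c} \<and>
     support (c i) = support (fst h, fst h + snd h))"

lemma curve_at_eq:
  assumes "covering \<C>" "curve_in \<C> c" "support (c i) = support (P, P + d)"
  shows "curve_at \<C> (P, d) = index_shift `` {c}"
  unfolding curve_at_def
proof (rule some_equality)
  show "\<exists>c' i'. curve_in \<C> c' \<and> index_shift `` {c} = index_shift `` {c'} \<and>
      support (c' i') = support (fst (P, d), fst (P, d) + snd (P, d))"
    using assms(2,3) by auto
next
  fix K assume "\<exists>c' i'. curve_in \<C> c' \<and> K = index_shift `` {c'} \<and>
      support (c' i') = support (fst (P, d), fst (P, d) + snd (P, d))"
  then show "K = index_shift `` {c}"
    using covering_unique(2)[OF assms(1,2)] assms(3) by fastforce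
qed

lemma labelling_pairing:
  assumes C: "covering \<C>"
  shows "labelling (pairing \<C>) (curve_at \<C>)"
  unfolding labelling_def
proof (intro conjI allI ballI)
  show "pairing \<C> P \<in> {1, -1}" for P by (simp add: pairing_def)
next
  fix P d :: point assume d: "d \<in> dirs"
  show "curve_at \<C> (flip (P, d)) = curve_at \<C> (P, d)"
  proof -
    have "support (P + d, P + d + - d) = support (P, P + d)" by (simp add: support_eq_iff)
    then show ?thesis unfolding curve_at_def flip_def fst_conv snd_conv by (simp only:)
  qed
  obtain c i where c: "curve_in \<C> c"
    "c i = (P + d, P) \<and> c (i + 1) = (P, P + smul (pairing \<C> P) (swp d)) \<or>
     c i = (P + smul (pairing \<C> P) (swp d), P) \<and> c (i + 1) = (P, P + d)"
    using pass_pairing[OF C d, of P] unfolding pass_def by blast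
  have "\<exists>i. support (c i) = support (P, P + d)"
    "\<exists>i. support (c i) = support (P, P + smul (pairing \<C> P) (swp d))"
    using c(2) by (auto simp: support_eq_iff)
  then show "curve_at \<C> (P, smul (pairing \<C> P) (swp d)) = curve_at \<C> (P, d)"
    using curve_at_eq[OF C c(1)] by metis
qed

lemma covering_labels:
  assumes C: "covering \<C>"
  shows "\<C> \<subseteq> curve_at \<C> ` {h. snd h \<in> dirs}"
proof
  fix K assume "K \<in> \<C>"
  then obtain c where c: "curve_in \<C> c" "K = index_shift `` {c}" using covering_class[OF C] by blast
  have "curve_at \<C> (fst (c 0), direction (c 0)) = K"
    using curve_at_eq[OF C c(1), of 0 "fst (c 0)" "direction (c 0)"] c(2) segment_eq(1)[of "c 0"] by simp
  then show "K \<in> curve_at \<C> ` {h. snd h \<in> dirs}"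
    using curve_inD(1)[OF c(1), of 0] by force
qed

lemma curve_fold_path:
  assumes "curve_in \<C> c"
  shows "fold_path (\<lambda>k. fst (c k)) (\<lambda>k. direction (c k)) (associated_sequence c)"
  unfolding fold_path_def
proof (intro conjI allI)
  show "complete_folding_sequence (associated_sequence c)" by (rule curve_inD(5)[OF assms])
  fix k
  show d: "direction (c k) \<in> dirs" by (rule curve_inD(1)[OF assms])
  show "fst (c (k + 1)) = fst (c k) + direction (c k)"
    using curve_inD(2)[OF assms, of k] by (simp add: direction_def)
  show "direction (c (k + 1)) = smul (associated_sequence c k) (rot (direction (c k)))"
    using d curve_inD(3)[OF assms, of k]
    by (elim dirs_cases disjE)
      (simp_all add: associated_sequence_def turn_def Let_def smul_def rot_def swp_def)
qed

lemma curve_follows: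
  assumes "covering \<C>" "curve_in \<C> c"
  shows "direction (c (k + 1)) = smul (- pairing \<C> (fst (c (k + 1)))) (swp (direction (c k)))"
  using pass_eq_pairing[OF assms(1) curve_pass[OF assms(2), of k]]
  by (simp add: smul_def swp_def)

lemma translate_support: "(+) (pt v) ` support (A, B) = support (v + A, v + B)"
proof -
  have "pt (v + X) = pt v + pt X" for X by (simp add: pt_def)
  then show ?thesis by (simp add: support_def closed_segment_translation)
qed

lemma pairing_translate:
  assumes C: "covering \<C>" and p: "pass \<C> X (1, 0) d'" "pass \<C> (v + X) (1, 0) d'"
  shows "pairing \<C> (v + X) = pairing \<C> X"
  using pass_eq_pairing[OF C p(1)] pass_eq_pairing[OF C p(2)] by (simp add: smul_def swp_def)

text \<open>The segment on the edge east of \<open>X\<close> shows, by its decoration at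
  \<open>X\<close>, the partner of east, which fixes the sign there. Thus local isomorphism
  transports signs; the \<open>region\<close> clause locates the translated vertex.\<close>

lemma decorated_vertex:
  assumes C: "covering \<C>"
  shows "\<exists>\<delta>\<in>decorated_segments \<C>. \<forall>v. translate v \<delta> \<in> decorated_segments \<C> \<longrightarrow>
     pairing \<C> (v + X) = pairing \<C> X \<and> pt (v + X) \<in> region (translate v \<delta>)"
proof -
  define e :: point where "e = (1, 0)"
  have e: "e \<in> dirs" by (simp add: e_def dirs_def)
  obtain c i where c: "curve_in \<C> c" "c i = (X, X + e) \<or> c i = (X + e, X)"
    using covering_exists[OF C e] .
  define \<delta> where "\<delta> = (support (c (i - 1)), c i, support (c (i + 1)))"
  have \<delta>: "\<delta> \<in> decorated_segments \<C>"
    unfolding decorated_segments_eq[OF C] \<delta>_def using c(1) by blast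
  have "pairing \<C> (v + X) = pairing \<C> X \<and> pt (v + X) \<in> region (translate v \<delta>)"
    if dec: "translate v \<delta> \<in> decorated_segments \<C>" for v
  proof -
    obtain b j where b: "curve_in \<C> b" "translate v \<delta> = (support (b (j - 1)), b j, support (b (j + 1)))"
      using dec unfolding decorated_segments_eq[OF C] by blast
    from c(2) show ?thesis
    proof
      assume ci: "c i = (X, X + e)"
      define d' where "d' = - direction (c (i - 1))"
      have cp: "c (i - 1) = (X + d', X)"
        using segment_eq(2)[of "c (i - 1)"] curve_inD(2)[OF c(1), of "i - 1"] ci by (simp add: d'_def)
      have tr: "translate v \<delta> = (support (v + (X + d'), v + X), (v + X, v + (X + e)), (+) (pt v) ` support (c (i + 1)))"
        unfolding \<delta>_def cp ci translate_def by (simp add: translate_support)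
      have bj: "b j = (v + X, v + X + e)" using b(2) tr by (simp add: add.assoc)
      have "support (b (j - 1)) = support (v + X + d', v + X)" using b(2) tr by (simp add: add.assoc)
      moreover have "snd (b (j - 1)) = v + X" using curve_inD(2)[OF b(1), of "j - 1"] bj by simp
      moreover have "d' \<noteq> 0" using curve_inD(1)[OF c(1), of "i - 1"] zero_not_dirs by (auto simp: d'_def)
      \<comment> \<open>A support fixes a segment only up to orientation; the endpoint shared with
        \<open>b j\<close> excludes the reversed one.\<close>
      ultimately have bp: "b (j - 1) = (v + X + d', v + X)" by (auto simp: support_eq_iff)
      have "pass \<C> X e d'" unfolding pass_def
        using c(1) cp ci by (intro exI[of _ c] exI[of _ "i - 1"]) simp
      moreover have "pass \<C> (v + X) e d'" unfolding pass_def
        using b(1) bp bj by (intro exI[of _ b] exI[of _ "j - 1"]) simp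
      ultimately have "pairing \<C> (v + X) = pairing \<C> X"
        using pairing_translate[OF C] unfolding e_def by blast
      then show ?thesis unfolding tr by (simp add: region_def support_def)
    next
      assume ci: "c i = (X + e, X)"
      define d' where "d' = direction (c (i + 1))"
      have cp: "c (i + 1) = (X, X + d')"
        using segment_eq(1)[of "c (i + 1)"] curve_inD(2)[OF c(1), of i] ci by (simp add: d'_def)
      have tr: "translate v \<delta> = ((+) (pt v) ` support (c (i - 1)), (v + (X + e), v + X), support (v + X, v + (X + d')))"
        unfolding \<delta>_def cp ci translate_def by (simp add: translate_support)
      have bj: "b j = (v + X + e, v + X)" using b(2) tr by (simp add: add.assoc)
      have "support (b (j + 1)) = support (v + X, v + X + d')" using b(2) tr by (simp add: add.assoc)
      moreover have "fst (b (j + 1)) = v + X" using curve_inD(2)[OF b(1), of j] bj by simp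
      moreover have "d' \<noteq> 0" using curve_inD(1)[OF c(1), of "i + 1"] zero_not_dirs by (auto simp: d'_def)
      ultimately have bp: "b (j + 1) = (v + X, v + X + d')" by (auto simp: support_eq_iff)
      have "pass \<C> X e d'" unfolding pass_def
        using c(1) cp ci by (intro exI[of _ c] exI[of _ i]) simp
      moreover have "pass \<C> (v + X) e d'" unfolding pass_def
        using b(1) bp bj by (intro exI[of _ b] exI[of _ j]) simp
      ultimately have "pairing \<C> (v + X) = pairing \<C> X"
        using pairing_translate[OF C] unfolding e_def by blast
      then show ?thesis unfolding tr by (simp add: region_def support_def)
    qed
  qed
  then show ?thesis using \<delta> by blast
qed

section \<open>Compactness, and transfer from one curve to the covering\<close>

lemma obeys_mono: "obeys b s D \<epsilon> \<Longrightarrow> D' \<subseteq> D \<Longrightarrow> obeys b s D' \<epsilon>"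
  unfolding obeys_def by blast

lemma layered_mono: "layered n D \<epsilon> \<Longrightarrow> D' \<subseteq> D \<Longrightarrow> layered n D' \<epsilon>"
proof (induction n arbitrary: D D' \<epsilon>)
  case (Suc n)
  then obtain b s where "b \<in> {0, 1}" "s \<in> {1, -1}" "obeys b s D \<epsilon>"
    "layered n (phi b -` D) (deriv_field b s \<epsilon>)"
    by auto
  moreover have "obeys b s D' \<epsilon>" using calculation(3) Suc.prems(2) by (rule obeys_mono)
  moreover have "layered n (phi b -` D') (deriv_field b s \<epsilon>)"
    using Suc.IH[OF calculation(4)] Suc.prems(2) by (meson vimage_mono)
  ultimately show ?case unfolding layered.simps by blast
qed simp

text \<open>If each of the four pairs (b, s) failed on some finite set, all would fail on the union
  of these sets, by monotonicity in \<open>D\<close>.\<close>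

lemma layered_UNIV:
  "(\<And>D. finite D \<Longrightarrow> layered n D \<epsilon>) \<Longrightarrow> layered n UNIV \<epsilon>"
proof (induction n arbitrary: \<epsilon>)
  case (Suc n)
  let ?R = "\<lambda>b s D. obeys b s D \<epsilon> \<and> layered n (phi b -` D) (deriv_field b s \<epsilon>)"
  have "\<exists>b\<in>{0, 1}. \<exists>s\<in>{1, -1}. \<forall>D. finite D \<longrightarrow> ?R b s D"
  proof (rule ccontr)
    assume "\<not> ?thesis"
    then obtain f where f: "\<And>b s. b \<in> {0, 1} \<Longrightarrow> s \<in> {1, -1} \<Longrightarrow> finite (f b s) \<and> \<not> ?R b s (f b s)"
      by metis
    define D where "D = (\<Union>b\<in>{0, 1}. \<Union>s\<in>{1, -1}. f b s)"
    have "finite D" using f by (auto simp: D_def)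
    then obtain b s where bs: "b \<in> {0, 1}" "s \<in> {1, -1}" "?R b s D"
      using Suc.prems[of D] unfolding layered.simps by blast
    have sub: "f b s \<subseteq> D" unfolding D_def using bs(1,2) by blast
    have "obeys b s (f b s) \<epsilon>" using obeys_mono[OF _ sub] bs(3) by blast
    moreover have "layered n (phi b -` f b s) (deriv_field b s \<epsilon>)"
      using layered_mono[OF _ vimage_mono[OF sub]] bs(3) by blast
    ultimately show False using f[OF bs(1,2)] by blast
  qed
  then obtain b s where bs: "b \<in> {0, 1}" "s \<in> {1, -1}" and R: "\<And>D. finite D \<Longrightarrow> ?R b s D" by blast
  have "obeys b s UNIV \<epsilon>"
  proof -
    have "obeys b s {X} \<epsilon>" for X using R[of "{X}"] by blast
    then show ?thesis unfolding obeys_def by blast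
  qed
  moreover have "layered n UNIV (deriv_field b s \<epsilon>)"
  proof (rule Suc.IH)
    fix D :: "point set" assume "finite D"
    then have "layered n (phi b -` phi b ` D) (deriv_field b s \<epsilon>)" using R[of "phi b ` D"] by blast
    then show "layered n D (deriv_field b s \<epsilon>)" by (rule layered_mono) blast
  qed
  ultimately show ?case unfolding layered.simps vimage_UNIV using bs by blast
qed simp

lemma translate_path:
  "fold_path X u t \<Longrightarrow> fold_path (\<lambda>k. X k - v) u t"
  unfolding fold_path_def by (simp add: algebra_simps)

text \<open>A translate of \<open>D\<close> is found in a disc traversed by one curve. Moved back by
  \<open>- v\<close>, that curve visits all of \<open>D\<close> and follows the pairing there, so
  its own coarsening applies.\<close>

lemma layered_pairing:
  assumes C: "covering \<C>" and lip: "local_isomorphism_property \<C>" and D: "finite D"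
  shows "layered n D (pairing \<C>)"
proof -
  obtain \<delta> where \<delta>: "\<And>X. \<delta> X \<in> decorated_segments \<C>"
    "\<And>X v. translate v (\<delta> X) \<in> decorated_segments \<C> \<Longrightarrow>
       pairing \<C> (v + X) = pairing \<C> X \<and> pt (v + X) \<in> region (translate v (\<delta> X))"
    using decorated_vertex[OF C] by metis
  have "finite (\<delta> ` D) \<and> \<delta> ` D \<subseteq> decorated_segments \<C>" using D \<delta>(1) by blast
  then obtain r where r: "r > 0" "\<And>z. \<exists>v. translate v ` \<delta> ` D \<subseteq> decorated_segments \<C> \<and>
      (\<Union>d\<in>translate v ` \<delta> ` D. region d) \<subseteq> cball z r"
    using lip unfolding local_isomorphism_property_def by meson
  have "(1, 0) \<in> dirs" by (simp add: dirs_def)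
  then obtain c where c: "curve_in \<C> c" by (rule covering_exists[OF C, of _ 0])
  define X where "X k = fst (c k)" for k
  define u where "u k = direction (c k)" for k
  have path: "fold_path X u (associated_sequence c)"
    unfolding X_def u_def by (rule curve_fold_path[OF c])
  \<comment> \<open>The traversed radius has to reach r + 1/2, since the midpoint of the eastern
    edge of a vertex is 1/2 away from it.\<close>
  obtain m where m: "(r + 1) * 20 / 3 < sqrt 2 ^ m"
    using real_arch_pow[of "sqrt 2" "(r + 1) * 20 / 3"] by auto
  obtain z where z: "near z (5 / 4 + 3 / 20 * sqrt 2 ^ m) \<subseteq> traversed X u"
    using disc_traversed[OF path] by blast
  obtain v where v: "translate v ` \<delta> ` D \<subseteq> decorated_segments \<C>"
      "(\<Union>d\<in>translate v ` \<delta> ` D. region d) \<subseteq> cball (Re z, Im z) r"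
    using r(2)[of "(Re z, Im z)"] by blast
  have on_path: "v + A \<in> range X" and same: "pairing \<C> (v + A) = pairing \<C> A" if A: "A \<in> D" for A
  proof -
    have dec: "translate v (\<delta> A) \<in> decorated_segments \<C>" using v(1) A by blast
    show "pairing \<C> (v + A) = pairing \<C> A" using \<delta>(2)[OF dec] by blast
    have "pt (v + A) \<in> cball (Re z, Im z) r" using \<delta>(2)[OF dec] v(2) A by blast
    then have "cmod (cx (v + A) - z) \<le> r"
      by (simp add: pt_def cx_def dist_Pair_Pair dist_real_def cmod_def power2_commute)
    moreover have "cmod (cx (1, 0) / 2) = 1 / 2" by (simp add: norm_divide cmod_dirs dirs_def)
    ultimately have "cmod (mid (v + A, (1, 0)) - z) \<le> r + 1 / 2"
      using norm_triangle_ineq[of "cx (v + A) - z" "cx (1, 0) / 2"] by (simp add: mid_def algebra_simps)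
    moreover have "r + 1 / 2 \<le> 5 / 4 + 3 / 20 * sqrt 2 ^ m" using m by (simp add: field_simps)
    ultimately have "(v + A, (1, 0)) \<in> near z (5 / 4 + 3 / 20 * sqrt 2 ^ m)"
      by (simp add: near_def dirs_def)
    then have "(v + A, (1, 0)) \<in> traversed X u" using z by blast
    then obtain k where "v + A = X k \<or> v + A = X k + u k"
      unfolding traversed_def flip_def by auto
    then show "v + A \<in> range X" using path unfolding fold_path_def by (metis rangeI)
  qed
  have "D \<subseteq> range (\<lambda>k. X k - v)"
  proof
    fix A assume "A \<in> D"
    then obtain k where "v + A = X k" using on_path by blast
    then have "A = X k - v" by (metis add_diff_cancel_left')
    then show "A \<in> range (\<lambda>k. X k - v)" by blast
  qed
  moreover have "follows (pairing \<C>) D (\<lambda>k. X k - v) u"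
    unfolding follows_def
  proof (intro allI impI)
    fix k assume "X (k + 1) - v \<in> D"
    from same[OF this] have "pairing \<C> (X (k + 1) - v) = pairing \<C> (X (k + 1))" by simp
    then show "u (k + 1) = smul (- pairing \<C> (X (k + 1) - v)) (swp (u k))"
      using curve_follows[OF C c, of k] by (simp add: u_def X_def)
  qed
  ultimately show ?thesis by (rule layered_fold_path[OF translate_path[OF path]])
qed

theorem theorem3p12:
  fixes \<C> :: "(int \<Rightarrow> segment) set set"
  assumes "covering \<C>"
    and "local_isomorphism_property \<C>"
  shows "finite \<C> \<and> card \<C> \<le> 6"
proof -
  have "layered n UNIV (pairing \<C>)" for n
    by (rule layered_UNIV) (rule layered_pairing[OF assms])
  from layered_labels_le_6[OF labelling_pairing[OF assms(1)] this]
  show ?thesis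
    using covering_labels[OF assms(1)] by (meson card_mono finite_subset le_trans)
qed

end
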